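(* Let $G$ be a random $3$-regular graph on $n$ vertices ($n$ even). Then \[ \operatorname{gon}(G)\ge 0.072\,n \] asymptotically almost surely; that is, the probability that this inequality holds tends to $1$ as $n\to\infty$ through even integers.
   Context: Random $k$-regular graph on $n$ vertices (with $kn$ even), configuration model: take $n$ disjoint sets $W_1,\dots,W_n$ of $k$ elements each; a configuration is a partition of $W=\bigcup_j W_j$ into $2$-element sets, chosen uniformly at random among all such partitions. The associated $k$-regular multigraph has vertices $v_1,\dots,v_n$ and, for each pair in the partition consisting of an element of $W_i$ and an element of $W_j$, an edge between $v_i$ and $v_j$ (multiple edges and loops may occur; a loop contributes $2$ to the valence). $\varepsilon(v,w)$ is the number of edges between distinct vertices $v,w$. A divisor on $G$ is a formal $\mathbb{Z}$-linear combination $D=\sum_v D(v)\,v$ of vertices; its degree is $\sum_v D(v)$; it is effective if $D(v)\ge 0$ for all $v$. Firing a vertex $v$ replaces $D$ by $D'$ with $D'(v)=D(v)-\sum_{w\ne v}\varepsilon(v,w)$ and $D'(w)=D(w)+\varepsilon(w,v)$ for $w\neq v$ (loops play no role). Two divisors are equivalent if they differ by an integer combination of firing moves. A divisor $D$ has positive rank if for every vertex $v$ the divisor $D-v$ is equivalent to an effective divisor. The gonality $\operatorname{gon}(G)$ is the smallest degree of a divisor on $G$ of positive rank. *)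

theory Defs
  imports "HOL-Probability.Probability" "HOL-Library.Disjoint_Sets"
begin

(* Edges are named objects, so parallel edges are distinct elements of edges G.
   ends G e is the set of endpoints of e: a two-element set, or a singleton if e is a loop. *)
record ('v, 'e) multigraph =
  verts :: "'v set"
  edges :: "'e set"
  ends :: "'e \<Rightarrow> 'v set"

(* Only meaningful, and only used, for distinct v and w. *)
definition edge_mult :: "('v, 'e) multigraph \<Rightarrow> 'v \<Rightarrow> 'v \<Rightarrow> nat" where
  "edge_mult G v w = card {e \<in> edges G. ends G e = {v, w}}"

(* Formal integer combinations of vertices, extended by zero to the whole vertex type. *)
definition divisors :: "('v, 'e) multigraph \<Rightarrow> ('v \<Rightarrow> int) set" where
  "divisors G = {D. \<forall>v. v \<notin> verts G \<longrightarrow> D v = 0}"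

definition div_degree :: "('v, 'e) multigraph \<Rightarrow> ('v \<Rightarrow> int) \<Rightarrow> int" where
  "div_degree G D = (\<Sum>v\<in>verts G. D v)"

definition div_effective :: "('v, 'e) multigraph \<Rightarrow> ('v \<Rightarrow> int) \<Rightarrow> bool" where
  "div_effective G D \<longleftrightarrow> (\<forall>v\<in>verts G. D v \<ge> 0)"

(* The divisor that is added to D when the vertex v is fired. *)
definition firing_move :: "('v, 'e) multigraph \<Rightarrow> 'v \<Rightarrow> 'v \<Rightarrow> int" where
  "firing_move G v w =
     (if w = v then - (\<Sum>u\<in>verts G - {v}. int (edge_mult G v u))
      else int (edge_mult G w v))"

definition div_equiv :: "('v, 'e) multigraph \<Rightarrow> ('v \<Rightarrow> int) \<Rightarrow> ('v \<Rightarrow> int) \<Rightarrow> bool" where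
  "div_equiv G D D' \<longleftrightarrow>
     (\<exists>c :: 'v \<Rightarrow> int. \<forall>w\<in>verts G. D' w = D w + (\<Sum>v\<in>verts G. c v * firing_move G v w))"

definition positive_rank :: "('v, 'e) multigraph \<Rightarrow> ('v \<Rightarrow> int) \<Rightarrow> bool" where
  "positive_rank G D \<longleftrightarrow>
     (\<forall>v\<in>verts G. \<exists>E\<in>divisors G.
        div_effective G E \<and> div_equiv G (\<lambda>w. D w - (if w = v then 1 else 0)) E)"

(* On a finite nonempty graph the minimum exists: the all-ones divisor has positive rank,
   and equivalence preserves degree, so every divisor of positive rank has degree at least 1. *)
definition gonality :: "('v, 'e) multigraph \<Rightarrow> int" where
  "gonality G = (LEAST d. \<exists>D\<in>divisors G. positive_rank G D \<and> div_degree G D = d)"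

(* The cell W_j of the configuration model. *)
definition cell :: "nat \<Rightarrow> nat \<Rightarrow> (nat \<times> nat) set" where
  "cell k j = {j} \<times> {1..k}"

definition configurations :: "nat \<Rightarrow> nat \<Rightarrow> (nat \<times> nat) set set set" where
  "configurations k n = {P. partition_on (\<Union>j\<in>{1..n}. cell k j) P \<and> (\<forall>p\<in>P. card p = 2)}"

(* The pairs of the configuration are themselves the edges; the vertex v_j is the number j,
   which is the first component of every element of W_j. *)
definition config_graph :: "nat \<Rightarrow> (nat \<times> nat) set set \<Rightarrow> (nat, (nat \<times> nat) set) multigraph" where
  "config_graph n P = \<lparr>verts = {1..n}, edges = P, ends = (\<lambda>p. fst ` p)\<rparr>"

(* Intended for even k * n, in which case the finite set of configurations is nonempty. *)
definition random_regular_graph :: "nat \<Rightarrow> nat \<Rightarrow> (nat, (nat \<times> nat) set) multigraph pmf" where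
  "random_regular_graph k n = map_pmf (config_graph n) (pmf_of_set (configurations k n))"

end

theory Submission
  imports Defs "HOL-Real_Asymp.Real_Asymp"
begin

text \<open>
  Write \<open>\<alpha> = 0.072\<close>. The theorem combines a deterministic lower bound for the gonality of
  an expanding graph with a first moment estimate for expansion.

  Let \<open>D\<close> be a divisor of positive rank and degree \<open>d < \<alpha> n\<close> on a cubic graph. Passing between
  two equivalent effective divisors can be done by firing an increasing chain of vertex sets with
  every intermediate divisor effective, and a set can be fired in this way only if at most \<open>d\<close>
  edges leave it. Call a connected vertex set an egg if it has at least \<open>(1 - \<alpha>) n / 3\<close>
  vertices, and take an effective divisor \<open>F\<close> equivalent to \<open>D\<close> whose support meets as many eggs
  as possible. If some egg \<open>B\<close> is missed, move chips onto \<open>B\<close>; by maximality some egg \<open>A\<close> is lost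
  no later than \<open>B\<close> is gained, and since eggs are connected, the set fired when \<open>B\<close> is gained
  contains \<open>A\<close> and avoids \<open>B\<close> (\<open>scramble_alternative\<close>). That is a set with few
  leaving edges such that both it and its complement are large, which expansion forbids. If
  all eggs are met, then the complement of the support falls apart into components too
  small to be eggs; expansion gives each of them many leaving edges, altogether at least
  \<open>3 \<alpha> n\<close>, whereas at most \<open>3 d\<close> edges leave the support. So \<open>gon(G) \<ge> \<alpha> n\<close> as
  soon as every set of \<open>s \<le> n / 2\<close> vertices has at least \<open>min (\<alpha> n) (\<rho> s)\<close> leaving edges, where
  \<open>\<rho> = 3 \<alpha> / (1 - \<alpha>) = 27 / 116\<close> (\<open>gonality_ge_of_expansion\<close>). The two bounds
  agree at \<open>s = (1 - \<alpha>) n / 3 = (116 / 375) n\<close>.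

  For the random part, fix a set \<open>A\<close> of half-edges and \<open>0 < w \<le> 1\<close>. By symmetry the mean of
  \<open>w\<close> to the number of pairs that \<open>A\<close> splits depends only on the cardinality of \<open>A\<close>, so one may
  average over \<open>A\<close> instead of over the pairing; for a fixed pairing the generating function over
  all \<open>A\<close> is a power of \<open>1 + 2 x w + x\<^sup>2\<close>, one factor for each pair. No pairings
  have to be counted. Markov's inequality and a union bound then estimate the
  probability that some set of \<open>s\<close> vertices has fewer than \<open>\<gamma>\<close> leaving edges. With
  \<open>x\<^sup>2 = s / (n - s)\<close>, which is nearly optimal, the estimate becomes, up to a factor
  quadratic in \<open>s\<close>, the exponential of

    \<open>- n H(s/n) / 2 + 3 w sqrt (s (n - s)) - \<gamma> ln w\<close>,

  with \<open>H\<close> the entropy function (\<open>small_crossing_probability_entropy\<close>). What remains is to choose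
  \<open>w\<close> by calculus in the two ranges of \<open>s\<close>, to check that the exponent is negative at the
  breakpoint, and to sum over \<open>s\<close>.
\<close>

section \<open>Firing scripts and cuts\<close>

text \<open>
  The divisor reached from \<open>D\<close> when each vertex \<open>v\<close> is fired \<open>c v\<close> times. Only differences of
  \<open>c\<close> enter, so adding a constant to \<open>c\<close> changes nothing.
\<close>

definition fire :: "('v, 'e) multigraph \<Rightarrow> ('v \<Rightarrow> int) \<Rightarrow> ('v \<Rightarrow> int) \<Rightarrow> 'v \<Rightarrow> int" where
  "fire G c D w = D w + (\<Sum>v\<in>verts G. (c v - c w) * int (edge_mult G v w))"

definition cut_size :: "('v, 'e) multigraph \<Rightarrow> 'v set \<Rightarrow> nat" where
  "cut_size G U = (\<Sum>u\<in>U. \<Sum>w\<in>verts G - U. edge_mult G u w)"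

text \<open>
  Connectedness of the induced subgraph, in the form in which it is used: no
  bipartition of \<open>A\<close> without an edge across.
\<close>

definition connected_in :: "('v, 'e) multigraph \<Rightarrow> 'v set \<Rightarrow> bool" where
  "connected_in G A \<longleftrightarrow> A \<noteq> {} \<and>
     (\<forall>X. X \<subseteq> A \<and> X \<noteq> {} \<and> X \<noteq> A \<longrightarrow> (\<exists>x\<in>X. \<exists>y\<in>A - X. edge_mult G x y > 0))"

lemma edge_mult_commute: "edge_mult G v w = edge_mult G w v"
  by (simp add: edge_mult_def insert_commute)

lemma sum_firing_move:
  assumes "finite (verts G)" "w \<in> verts G"
  shows "(\<Sum>v\<in>verts G. c v * firing_move G v w) = (\<Sum>v\<in>verts G. (c v - c w) * int (edge_mult G v w))"
proof -
  have "(\<Sum>v\<in>verts G. c v * firing_move G v w)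
      = c w * firing_move G w w + (\<Sum>v\<in>verts G - {w}. c v * firing_move G v w)"
    using assms by (simp add: sum.remove)
  also have "(\<Sum>v\<in>verts G - {w}. c v * firing_move G v w) = (\<Sum>v\<in>verts G - {w}. c v * int (edge_mult G v w))"
    by (rule sum.cong) (auto simp: firing_move_def edge_mult_commute)
  also have "c w * firing_move G w w = (\<Sum>v\<in>verts G - {w}. - c w * int (edge_mult G v w))"
    by (simp add: firing_move_def sum_distrib_left sum_negf edge_mult_commute)
  also have "\<dots> + (\<Sum>v\<in>verts G - {w}. c v * int (edge_mult G v w))
      = (\<Sum>v\<in>verts G - {w}. (c v - c w) * int (edge_mult G v w))"
    by (simp add: sum.distrib [symmetric] algebra_simps)
  also have "\<dots> = (\<Sum>v\<in>verts G. (c v - c w) * int (edge_mult G v w))"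
    using assms by (simp add: sum.remove)
  finally show ?thesis .
qed

lemma div_equiv_iff_fire:
  assumes "finite (verts G)"
  shows "div_equiv G D E \<longleftrightarrow> (\<exists>c. \<forall>w\<in>verts G. E w = fire G c D w)"
  using sum_firing_move [OF assms] by (auto simp: div_equiv_def fire_def)

lemma fire_fire: "fire G c (fire G b D) = fire G (\<lambda>v. b v + c v) D"
  by (auto simp: fire_def sum.distrib [symmetric] algebra_simps fun_eq_iff)

lemma fire_cong:
  "w \<in> verts G \<Longrightarrow> (\<And>v. v \<in> verts G \<Longrightarrow> D v = E v) \<Longrightarrow> fire G c D w = fire G c E w"
  by (simp add: fire_def)

lemma div_equiv_sym:
  assumes "finite (verts G)" "div_equiv G D E"
  shows "div_equiv G E D"
proof -
  obtain c where c: "\<And>w. w \<in> verts G \<Longrightarrow> E w = fire G c D w"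
    using assms by (auto simp: div_equiv_iff_fire)
  have "D w = fire G (\<lambda>v. - c v) E w" if "w \<in> verts G" for w
  proof -
    have "fire G (\<lambda>v. - c v) E w = fire G (\<lambda>v. - c v) (fire G c D) w"
      by (rule fire_cong) (use that c in auto)
    also have "\<dots> = D w" by (simp add: fire_fire) (simp add: fire_def)
    finally show ?thesis by simp
  qed
  then show ?thesis using assms(1) by (auto simp: div_equiv_iff_fire)
qed

lemma div_equiv_trans:
  assumes "finite (verts G)" "div_equiv G D E" "div_equiv G E F"
  shows "div_equiv G D F"
proof -
  obtain c where c: "\<And>w. w \<in> verts G \<Longrightarrow> E w = fire G c D w"
    using assms by (auto simp: div_equiv_iff_fire)
  obtain b where b: "\<And>w. w \<in> verts G \<Longrightarrow> F w = fire G b E w"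
    using assms by (auto simp: div_equiv_iff_fire)
  have "F w = fire G (\<lambda>v. c v + b v) D w" if "w \<in> verts G" for w
    using that b c by (simp add: fire_fire [symmetric]) (rule fire_cong, auto)
  then show ?thesis using assms(1) by (auto simp: div_equiv_iff_fire)
qed

lemma sum_fire:
  "(\<Sum>w\<in>verts G. fire G c D w) = (\<Sum>w\<in>verts G. D w)"
proof -
  have "(\<Sum>w\<in>verts G. \<Sum>v\<in>verts G. c v * int (edge_mult G v w))
      = (\<Sum>w\<in>verts G. \<Sum>v\<in>verts G. c w * int (edge_mult G v w))"
    by (subst sum.swap) (simp add: edge_mult_commute)
  then show ?thesis by (simp add: fire_def sum.distrib sum_subtractf algebra_simps)
qed

lemma div_degree_equiv:
  assumes "finite (verts G)" "div_equiv G D E"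
  shows "div_degree G E = div_degree G D"
proof -
  obtain c where "\<And>w. w \<in> verts G \<Longrightarrow> E w = fire G c D w"
    using assms by (auto simp: div_equiv_iff_fire)
  then have "div_degree G E = (\<Sum>w\<in>verts G. fire G c D w)"
    by (simp add: div_degree_def)
  then show ?thesis by (simp add: sum_fire div_degree_def)
qed

lemma fire_indicator:
  assumes "finite (verts G)" "U \<subseteq> verts G"
  shows "fire G (\<lambda>v. of_bool (v \<in> U)) D w =
    (if w \<in> U then D w - (\<Sum>v\<in>verts G - U. int (edge_mult G v w)) else D w + (\<Sum>v\<in>U. int (edge_mult G v w)))"
proof -
  have "(\<Sum>v\<in>verts G. (of_bool (v \<in> U) - of_bool (w \<in> U)) * int (edge_mult G v w))
     = (\<Sum>v\<in>verts G - U. (of_bool (v \<in> U) - of_bool (w \<in> U)) * int (edge_mult G v w))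
      + (\<Sum>v\<in>U. (of_bool (v \<in> U) - of_bool (w \<in> U)) * int (edge_mult G v w))"
    using assms by (simp add: sum.subset_diff)
  then show ?thesis by (auto simp: fire_def sum_negf)
qed

text \<open>
  Firing \<open>U\<close> takes one chip from \<open>U\<close> for each edge that leaves \<open>U\<close>, so these edges are paid for
  by the chips of \<open>D\<close>.
\<close>

lemma cut_size_le_degree:
  assumes "finite (verts G)" "U \<subseteq> verts G" "div_effective G D"
    and "div_effective G (fire G (\<lambda>v. of_bool (v \<in> U)) D)"
  shows "int (cut_size G U) \<le> div_degree G D"
proof -
  have "int (cut_size G U) = (\<Sum>u\<in>U. \<Sum>w\<in>verts G - U. int (edge_mult G w u))"
    by (simp add: cut_size_def edge_mult_commute)
  also have "\<dots> \<le> (\<Sum>u\<in>U. D u)"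
  proof (rule sum_mono)
    fix u assume "u \<in> U"
    then have "0 \<le> fire G (\<lambda>v. of_bool (v \<in> U)) D u"
      using assms by (auto simp: div_effective_def)
    then show "(\<Sum>w\<in>verts G - U. int (edge_mult G w u)) \<le> D u"
      using \<open>u \<in> U\<close> by (simp add: fire_indicator assms)
  qed
  also have "\<dots> \<le> div_degree G D"
    unfolding div_degree_def using assms by (intro sum_mono2) (auto simp: div_effective_def)
  finally show ?thesis .
qed

section \<open>Chips entering and leaving connected sets\<close>

definition hit :: "('v \<Rightarrow> int) \<Rightarrow> 'v set \<Rightarrow> bool" where
  "hit D A \<longleftrightarrow> (\<exists>v\<in>A. D v > 0)"

lemma hit_cong: "(\<And>v. v \<in> A \<Longrightarrow> D v = E v) \<Longrightarrow> hit D A \<longleftrightarrow> hit E A"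
  by (simp add: hit_def)

text \<open>
  If \<open>A\<close> were only partly in \<open>U\<close>, some edge would carry a chip from \<open>A \<inter> U\<close> to \<open>A - U\<close>, and
  that chip would still be on \<open>A\<close> afterwards.
\<close>

lemma hit_lost_imp_subset:
  assumes fin: "finite (verts G)" and U: "U \<subseteq> verts G" and A: "A \<subseteq> verts G" "connected_in G A"
    and eff: "div_effective G D"
    and hit: "hit D A" "\<not> hit (fire G (\<lambda>v. of_bool (v \<in> U)) D) A"
  shows "A \<subseteq> U"
proof (rule ccontr)
  assume "\<not> A \<subseteq> U"
  obtain v where v: "v \<in> A" "D v > 0" using hit by (auto simp: hit_def)
  have grow: "D w + int (edge_mult G u w) \<le> fire G (\<lambda>v. of_bool (v \<in> U)) D w"
    if "w \<in> A - U" "u \<in> U" for u w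
  proof -
    have "int (edge_mult G u w) \<le> (\<Sum>v\<in>U. int (edge_mult G v w))"
      using that U fin by (intro member_le_sum) (auto intro: finite_subset)
    then show ?thesis using that by (simp add: fire_indicator fin U)
  qed
  have "v \<in> U"
  proof (rule ccontr)
    assume "v \<notin> U"
    then have "D v \<le> fire G (\<lambda>v. of_bool (v \<in> U)) D v"
      by (simp add: fire_indicator fin U sum_nonneg)
    with v hit show False by (force simp: hit_def)
  qed
  with v \<open>\<not> A \<subseteq> U\<close> A obtain x y where xy: "x \<in> A \<inter> U" "y \<in> A - (A \<inter> U)" "edge_mult G x y > 0"
    unfolding connected_in_def by (metis Int_iff Int_lower1 empty_iff inf.absorb_iff1)
  have "D y \<ge> 0" using xy A eff by (auto simp: div_effective_def)
  with grow [of y x] xy have "fire G (\<lambda>v. of_bool (v \<in> U)) D y > 0" by auto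
  with hit xy show False by (force simp: hit_def)
qed

text \<open>
  The time reversal of the preceding lemma: firing the complement of \<open>U\<close> undoes the
  firing of \<open>U\<close>.
\<close>

lemma hit_gained_imp_disjoint:
  assumes fin: "finite (verts G)" and U: "U \<subseteq> verts G" and A: "A \<subseteq> verts G" "connected_in G A"
    and eff: "div_effective G (fire G (\<lambda>v. of_bool (v \<in> U)) D)"
    and hit: "\<not> hit D A" "hit (fire G (\<lambda>v. of_bool (v \<in> U)) D) A"
  shows "A \<inter> U = {}"
proof -
  let ?E = "fire G (\<lambda>v. of_bool (v \<in> U)) D"
  have "fire G (\<lambda>v. of_bool (v \<in> verts G - U)) ?E w = D w" if "w \<in> verts G" for w
  proof -
    have "fire G (\<lambda>v. of_bool (v \<in> verts G - U)) ?E w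
        = D w + (\<Sum>v\<in>verts G. (of_bool (v \<in> U) + of_bool (v \<in> verts G - U)
           - (of_bool (w \<in> U) + of_bool (w \<in> verts G - U))) * int (edge_mult G v w))"
      unfolding fire_fire by (simp add: fire_def)
    also have "\<dots> = D w" using that by (auto intro!: sum.neutral)
    finally show ?thesis .
  qed
  then have "\<not> hit (fire G (\<lambda>v. of_bool (v \<in> verts G - U)) ?E) A"
    using hit A by (auto simp: hit_def)
  from hit_lost_imp_subset [OF fin _ A eff hit(2) this] show ?thesis by auto
qed

text \<open>
  This makes the level sets of \<open>c\<close> a legal firing sequence. A vertex with \<open>c w \<le> t\<close> has not fired
  yet and has only received chips since \<open>D\<close>; a vertex with \<open>c w > t\<close> takes part in all later
  firings and only loses chips until the final divisor, which is nonnegative.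
\<close>

lemma truncated_firing_effective:
  assumes "div_effective G D" "div_effective G (fire G c D)"
  shows "div_effective G (fire G (\<lambda>v. max (c v - t) 0) D)"
  unfolding div_effective_def
proof
  fix w assume w: "w \<in> verts G"
  show "0 \<le> fire G (\<lambda>v. max (c v - t) 0) D w"
  proof (cases "c w \<le> t")
    case True
    then show ?thesis using assms w
      by (auto simp: fire_def div_effective_def intro!: add_nonneg_nonneg sum_nonneg)
  next
    case False
    have "fire G c D w \<le> fire G (\<lambda>v. max (c v - t) 0) D w"
      unfolding fire_def using False by (intro add_left_mono sum_mono mult_right_mono) auto
    then show ?thesis using assms w by (force simp: div_effective_def)
  qed
qed

section \<open>The scramble argument\<close>

lemma card_support_le_degree:
  assumes "finite (verts G)" "div_effective G D"
  shows "int (card {v \<in> verts G. D v > 0}) \<le> div_degree G D"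
proof -
  have "int (card {v \<in> verts G. D v > 0}) = (\<Sum>v | v \<in> verts G \<and> D v > 0. 1)" by simp
  also have "\<dots> \<le> (\<Sum>v | v \<in> verts G \<and> D v > 0. D v)" by (rule sum_mono) auto
  also have "\<dots> \<le> div_degree G D"
    unfolding div_degree_def using assms by (intro sum_mono2) (auto simp: div_effective_def)
  finally show ?thesis .
qed

text \<open>
  The scramble bound on gonality, with the two invariants of a scramble (the size of a hitting
  set and of a cut separating two eggs) spelled out. The divisor \<open>F\<close> is chosen so that its support
  meets the greatest number of eggs. When chips are moved onto a missed egg \<open>B\<close>, the divisor
  at which \<open>B\<close> is first met cannot meet more eggs than \<open>F\<close>, so an egg \<open>A\<close> has been
  lost by then. The fired sets increase along the way, so the set fired when \<open>A\<close> was lost, which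
  contains \<open>A\<close>, is contained in the one fired when \<open>B\<close> is gained, which avoids \<open>B\<close>.
\<close>

lemma scramble_alternative:
  assumes fin: "finite (verts G)" and ne: "verts G \<noteq> {}"
    and eggs: "\<And>A. A \<in> \<A> \<Longrightarrow> A \<subseteq> verts G \<and> connected_in G A"
    and rank: "positive_rank G D"
  shows "(\<exists>S \<subseteq> verts G. int (card S) \<le> div_degree G D \<and> (\<forall>A\<in>\<A>. A \<inter> S \<noteq> {})) \<or>
         (\<exists>U \<subseteq> verts G. \<exists>A\<in>\<A>. \<exists>B\<in>\<A>. A \<subseteq> U \<and> B \<inter> U = {} \<and> int (cut_size G U) \<le> div_degree G D)"
proof -
  define Eff where "Eff F \<longleftrightarrow> div_effective G F \<and> div_equiv G D F" for F
  define hits where "hits F = {A \<in> \<A>. hit F A}" for F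
  have finA: "finite \<A>" using fin eggs by (intro finite_subset [of \<A> "Pow (verts G)"]) auto
  have reach: "\<exists>F. Eff F \<and> F v > 0" if v: "v \<in> verts G" for v
  proof -
    obtain E where E: "div_effective G E" "div_equiv G (\<lambda>w. D w - (if w = v then 1 else 0)) E"
      using rank v by (auto simp: positive_rank_def)
    then obtain c where c: "\<And>w. w \<in> verts G \<Longrightarrow> E w = fire G c (\<lambda>w. D w - (if w = v then 1 else 0)) w"
      using fin by (auto simp: div_equiv_iff_fire)
    then have "E w + (if w = v then 1 else 0) = fire G c D w" if "w \<in> verts G" for w
      using that by (simp add: fire_def)
    then have "div_equiv G D (\<lambda>w. E w + (if w = v then 1 else 0))"
      using fin by (auto simp: div_equiv_iff_fire)
    moreover have "div_effective G (\<lambda>w. E w + (if w = v then 1 else 0))" "E v \<ge> 0"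
      using E v by (auto simp: div_effective_def)
    ultimately show ?thesis unfolding Eff_def by (intro exI [of _ "\<lambda>w. E w + (if w = v then 1 else 0)"]) auto
  qed
  have hits_le: "card (hits F) \<le> card \<A>" for F
    unfolding hits_def using finA by (intro card_mono) auto
  obtain F0 where "Eff F0" using reach ne by blast
  then obtain F where F: "Eff F" "\<And>F'. Eff F' \<Longrightarrow> card (hits F') \<le> card (hits F)"
    using ex_has_greatest_nat [of Eff F0 "\<lambda>F. card (hits F)" "Suc (card \<A>)"] hits_le by (metis le_imp_less_Suc)
  have degF: "div_degree G F = div_degree G D"
    using F fin by (auto simp: Eff_def div_degree_equiv)
  show ?thesis
  proof (cases "\<forall>A\<in>\<A>. hit F A")
    case True
    then have "\<forall>A\<in>\<A>. A \<inter> {v \<in> verts G. F v > 0} \<noteq> {}"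
      using eggs by (fastforce simp: hit_def)
    moreover have "int (card {v \<in> verts G. F v > 0}) \<le> div_degree G D"
      using card_support_le_degree [OF fin, of F] F(1) degF by (simp add: Eff_def)
    ultimately show ?thesis
      by (intro disjI1 exI [of _ "{v \<in> verts G. F v > 0}"]) auto
  next
    case False
    then obtain B where B: "B \<in> \<A>" "\<not> hit F B" by auto
    obtain b where b: "b \<in> B" using eggs [OF B(1)] by (auto simp: connected_in_def)
    then have bG: "b \<in> verts G" using eggs [OF B(1)] by auto
    obtain E where E: "Eff E" "E b > 0" using reach bG by blast
    have "div_equiv G F E"
      using F(1) E(1) div_equiv_sym div_equiv_trans fin unfolding Eff_def by blast
    then obtain c where c: "\<And>w. w \<in> verts G \<Longrightarrow> E w = fire G c F w"
      using fin by (auto simp: div_equiv_iff_fire)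
    define M where "M = Max (c ` verts G)"
    define m where "m = Min (c ` verts G)"
    have M: "c v \<le> M" and m: "m \<le> c v" if "v \<in> verts G" for v
      using that fin by (auto simp: M_def m_def)
    have "m \<le> M" using m M bG by force
    \<comment> \<open>The chain of effective divisors from \<open>F\<close> to \<open>E\<close>: step \<open>k\<close> fires the superlevel set \<open>U k\<close>.\<close>
    define L where "L k = fire G (\<lambda>v. max (c v - (M - int k)) 0) F" for k
    define U where "U k = {v \<in> verts G. c v \<ge> M - int k}" for k
    have effL: "div_effective G (L k)" for k
      unfolding L_def using F(1) E(1) c
      by (intro truncated_firing_effective) (auto simp: Eff_def div_effective_def)
    have EffL: "Eff (L k)" for k
    proof -
      have "div_equiv G F (L k)" using fin unfolding L_def by (auto simp: div_equiv_iff_fire)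
      then show ?thesis using effL F(1) div_equiv_trans fin unfolding Eff_def by blast
    qed
    have L0: "L 0 w = F w" if "w \<in> verts G" for w
      using that M by (auto simp: L_def fire_def max_def intro!: sum.neutral)
    have LE: "L (nat (M - m)) w = E w" if "w \<in> verts G" for w
      using that m \<open>m \<le> M\<close> c by (auto simp: L_def fire_def intro!: sum.cong)
    have LSuc: "L (Suc k) w = fire G (\<lambda>v. of_bool (v \<in> U k)) (L k) w" if "w \<in> verts G" for w k
    proof -
      have "max (c v - (M - int (Suc k))) 0 = max (c v - (M - int k)) 0 + of_bool (v \<in> U k)"
        if "v \<in> verts G" for v
        using that by (auto simp: U_def)
      then show ?thesis using that unfolding L_def fire_fire by (simp add: fire_def)
    qed
    have fire_eff: "div_effective G (fire G (\<lambda>v. of_bool (v \<in> U k)) (L k))" for k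
      using effL [of "Suc k"] LSuc by (auto simp: div_effective_def)
    have hitSuc: "hit (L (Suc k)) A \<longleftrightarrow> hit (fire G (\<lambda>v. of_bool (v \<in> U k)) (L k)) A" if "A \<in> \<A>" for A k
      by (rule hit_cong) (use eggs [OF that] LSuc in blast)
    have UG: "U k \<subseteq> verts G" for k by (auto simp: U_def)
    \<comment> \<open>\<open>B\<close> is met for the first time at \<open>L k\<close>, by firing \<open>U i\<close> with \<open>k = Suc i\<close>.\<close>
    define k where "k = (LEAST k. hit (L k) B)"
    have "hit (L (nat (M - m))) B" unfolding hit_def using LE [OF bG] b E(2) by (metis)
    then have k: "hit (L k) B" "\<And>j. hit (L j) B \<Longrightarrow> k \<le> j"
      unfolding k_def by (rule LeastI) (rule Least_le)
    have "\<not> hit (L 0) B" using B(2) hit_cong [of B "L 0" F] L0 eggs [OF B(1)] by blast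
    with k obtain i where i: "k = Suc i" by (cases k) auto
    have nB: "\<not> hit (L i) B" using k(2) [of i] i by auto
    have BU: "B \<inter> U i = {}"
      using hit_gained_imp_disjoint [OF fin UG _ _ fire_eff nB] eggs [OF B(1)] k(1) i hitSuc [OF B(1)] by auto
    have "\<exists>A\<in>\<A>. hit F A \<and> \<not> hit (L k) A"
    proof (rule ccontr)
      assume "\<not> ?thesis"
      then have "hits F \<subset> hits (L k)" using B k by (auto simp: hits_def)
      then have "card (hits F) < card (hits (L k))"
        using finA by (intro psubset_card_mono) (auto simp: hits_def)
      with F(2) [OF EffL] show False by (simp add: not_le [symmetric])
    qed
    then obtain A where A: "A \<in> \<A>" "hit F A" "\<not> hit (L k) A" by auto
    \<comment> \<open>\<open>A\<close> is lost for the first time at \<open>L j\<close>, by firing \<open>U l\<close> with \<open>j = Suc l\<close>.\<close>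
    define j where "j = (LEAST j. \<not> hit (L j) A)"
    have j: "\<not> hit (L j) A" "\<And>l. \<not> hit (L l) A \<Longrightarrow> j \<le> l"
      unfolding j_def by (rule LeastI [of "\<lambda>j. \<not> hit (L j) A", OF A(3)]) (rule Least_le)
    have "hit (L 0) A" using A(2) hit_cong [of A "L 0" F] L0 eggs [OF A(1)] by blast
    with j obtain l where l: "j = Suc l" by (cases j) auto
    have "l \<le> i" using j(2) [of k] A l i by auto
    have "hit (L l) A" using j(2) [of l] l by auto
    then have "A \<subseteq> U l"
      using hit_lost_imp_subset [OF fin UG _ _ effL] eggs [OF A(1)] j(1) l hitSuc [OF A(1)] by auto
    also have "U l \<subseteq> U i" using \<open>l \<le> i\<close> by (auto simp: U_def)
    finally have "A \<subseteq> U i" .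
    moreover have "int (cut_size G (U i)) \<le> div_degree G D"
      using cut_size_le_degree [OF fin UG effL fire_eff, of i] EffL [of i] div_degree_equiv [OF fin]
      unfolding Eff_def by metis
    ultimately show ?thesis using BU A(1) B(1) UG [of i]
      by (intro disjI2 exI [of _ "U i"] conjI bexI [of _ A] bexI [of _ B])
  qed
qed

section \<open>Gonality of expanding graphs\<close>

lemma cut_size_compl:
  assumes "U \<subseteq> verts G"
  shows "cut_size G (verts G - U) = cut_size G U"
proof -
  have "verts G - (verts G - U) = U" using assms by auto
  then show ?thesis unfolding cut_size_def
    by (subst sum.swap) (simp add: edge_mult_commute)
qed

lemma cut_size_union_unlinked:
  assumes fin: "finite (verts G)" and sub: "X \<subseteq> A" "A \<subseteq> verts G"
    and no: "\<And>x y. x \<in> X \<Longrightarrow> y \<in> A - X \<Longrightarrow> edge_mult G x y = 0"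
  shows "cut_size G A = cut_size G X + cut_size G (A - X)"
proof -
  have finA: "finite A" using fin sub finite_subset by blast
  have 1: "(\<Sum>w\<in>verts G - X. edge_mult G x w) = (\<Sum>w\<in>verts G - A. edge_mult G x w)" if "x \<in> X" for x
    using that no sub fin by (intro sum.mono_neutral_right) auto
  have 2: "(\<Sum>w\<in>verts G - (A - X). edge_mult G x w) = (\<Sum>w\<in>verts G - A. edge_mult G x w)" if "x \<in> A - X" for x
    using that no sub fin edge_mult_commute [of G x] by (intro sum.mono_neutral_right) auto
  show ?thesis unfolding cut_size_def
    using 1 2 sub finA by (simp add: sum.subset_diff [of X A])
qed

text \<open>
  The cut of \<open>A\<close> is the sum of the cuts of its components, each of which is small. Splitting
  a disconnected \<open>A\<close> repeatedly into two unlinked parts avoids speaking of components.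
\<close>

lemma cut_size_of_small_components:
  fixes \<rho> t :: real
  assumes fin: "finite (verts G)"
    and small: "\<And>X. X \<subseteq> A \<Longrightarrow> X \<noteq> {} \<Longrightarrow> real (card X) < t \<Longrightarrow> \<rho> * card X \<le> cut_size G X"
    and conn: "\<And>X. X \<subseteq> A \<Longrightarrow> connected_in G X \<Longrightarrow> real (card X) < t"
    and "A \<subseteq> verts G"
  shows "\<rho> * card A \<le> cut_size G A"
  using assms(2-4)
proof (induction "card A" arbitrary: A rule: less_induct)
  case less
  have finA: "finite A" using less.prems(3) fin finite_subset by blast
  consider "A = {}" | "connected_in G A" | "A \<noteq> {}" "\<not> connected_in G A" by blast
  then show ?case
  proof cases
    case 1
    then show ?thesis by simp
  next
    case 2
    then show ?thesis using less.prems by (auto simp: connected_in_def)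
  next
    case split: 3
    then obtain X where "X \<subseteq> A \<and> X \<noteq> {} \<and> X \<noteq> A" "\<not> (\<exists>x\<in>X. \<exists>y\<in>A - X. edge_mult G x y > 0)"
      unfolding connected_in_def by blast
    then have 3: "X \<subseteq> A" "X \<noteq> {}" "X \<noteq> A"
      and unlinked: "\<And>x y. x \<in> X \<Longrightarrow> y \<in> A - X \<Longrightarrow> edge_mult G x y = 0" by auto
    have IH: "\<rho> * card Y \<le> cut_size G Y" if Y: "Y \<subset> A" for Y
    proof (rule less.hyps)
      show "card Y < card A" using finA Y by (rule psubset_card_mono)
      show "\<rho> * card Z \<le> cut_size G Z" if "Z \<subseteq> Y" "Z \<noteq> {}" "real (card Z) < t" for Z
        using that Y less.prems(1) by blast
      show "real (card Z) < t" if "Z \<subseteq> Y" "connected_in G Z" for Z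
        using that Y less.prems(2) by blast
      show "Y \<subseteq> verts G" using Y less.prems(3) by blast
    qed
    have "X \<subset> A" "A - X \<subset> A" using 3 by auto
    note IH [OF this(1)] IH [OF this(2)]
    moreover have "card A = card X + card (A - X)"
      using 3 finA card_mono [of A X] card_Diff_subset [of X A] finite_subset [of X A] by simp
    ultimately show ?thesis using cut_size_union_unlinked [OF fin 3(1) less.prems(3) unlinked]
      by (simp add: algebra_simps)
  qed
qed

text \<open>
  The degrees of divisors of positive rank are nonnegative, and the all-ones divisor shows that
  there are any, so the least integer in the definition of gonality exists.
\<close>

lemma gonality_attained:
  assumes fin: "finite (verts G)"  and ne: "verts G \<noteq> {}"
  obtains D where "positive_rank G D" "div_degree G D = gonality G"
proof -
  define R where "R d \<longleftrightarrow> (\<exists>D\<in>divisors G. positive_rank G D \<and> div_degree G D = d)" for d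
  define N where "N = (\<lambda>v. if v \<in> verts G then 1 else 0 :: int)"
  have "positive_rank G N"
    unfolding positive_rank_def
  proof
    fix v assume v: "v \<in> verts G"
    let ?E = "\<lambda>w. N w - (if w = v then 1 else 0)"
    have "?E \<in> divisors G" "div_effective G ?E" using v by (auto simp: divisors_def N_def div_effective_def)
    moreover have "div_equiv G ?E ?E" unfolding div_equiv_def by (rule exI [of _ "\<lambda>_. 0"]) auto
    ultimately show "\<exists>E\<in>divisors G. div_effective G E \<and> div_equiv G ?E E" by blast
  qed
  moreover have "N \<in> divisors G" by (auto simp: divisors_def N_def)
  ultimately have R: "R (div_degree G N)" by (auto simp: R_def)
  have pos: "d \<ge> 0" if d: "R d" for d
  proof -
    obtain D where D: "positive_rank G D" "div_degree G D = d" using d by (auto simp: R_def)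
    obtain v where v: "v \<in> verts G" using ne by auto
    then obtain E where E: "div_effective G E" "div_equiv G (\<lambda>w. D w - (if w = v then 1 else 0)) E"
      using D by (auto simp: positive_rank_def)
    have "0 \<le> div_degree G E" using E by (auto simp: div_degree_def div_effective_def intro: sum_nonneg)
    also have "\<dots> = d - 1" using div_degree_equiv [OF fin E(2)] D v fin
      by (simp add: div_degree_def sum_subtractf)
    finally show ?thesis by simp
  qed
  define d where "d = (LEAST k. R (int k))"
  have "R (int d)" unfolding d_def using R pos by (metis LeastI nat_0_le)
  have "gonality G = int d"
    unfolding gonality_def R_def [symmetric]
  proof (rule Least_equality)
    fix y assume "R y"
    then have "R (int (nat y))" "y \<ge> 0" using pos by auto
    then have "d \<le> nat y" unfolding d_def by (intro Least_le)
    with \<open>y \<ge> 0\<close> show "int d \<le> y" by simp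
  qed (fact \<open>R (int d)\<close>)
  with \<open>R (int d)\<close> that show ?thesis by (auto simp: R_def)
qed

text \<open>
  The slope \<open>\<rho> = k \<alpha> / (1 - \<alpha>)\<close> is what the hitting set case demands: the complement of a set
  \<open>S\<close> with fewer than \<open>\<alpha> n\<close> vertices has more than \<open>(1 - \<alpha>) n\<close> of them, but fewer than
  \<open>k \<alpha> n\<close> edges join the two. The size \<open>t\<close> from which on connected sets count as eggs is where the
  two terms of the minimum agree.
\<close>

theorem gonality_ge_of_expansion:
  fixes \<alpha> :: real
  assumes fin: "finite (verts G)" and ne: "verts G \<noteq> {}" and k: "2 \<le> k" and \<alpha>: "0 < \<alpha>" "\<alpha> < 1"
    and valence: "\<And>U. U \<subseteq> verts G \<Longrightarrow> cut_size G U \<le> k * card U"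
    and expand: "\<And>U. U \<subseteq> verts G \<Longrightarrow> U \<noteq> {} \<Longrightarrow> 2 * card U \<le> card (verts G) \<Longrightarrow>
      min (\<alpha> * card (verts G)) (k * \<alpha> / (1 - \<alpha>) * card U) \<le> cut_size G U"
  shows "\<alpha> * card (verts G) \<le> gonality G"
proof (rule ccontr)
  assume less: "\<not> ?thesis"
  define n where "n = card (verts G)"
  define \<rho> where "\<rho> = k * \<alpha> / (1 - \<alpha>)"
  define t where "t = (1 - \<alpha>) * n / k"
  obtain D where D: "positive_rank G D" "div_degree G D = gonality G"
    using gonality_attained [OF fin ne] .
  define d where "d = div_degree G D"
  have d: "d < \<alpha> * n" using less D by (simp add: d_def n_def)
  have "n > 0" using fin ne by (simp add: n_def card_gt_0_iff)
  have \<rho>: "\<rho> > 0" using k \<alpha> by (simp add: \<rho>_def)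
  have \<rho>t: "\<rho> * t = \<alpha> * n" using k \<alpha> by (simp add: \<rho>_def t_def)
  have t: "t \<le> n / 2"
  proof -
    have "(1 - \<alpha>) * real n * 2 \<le> 1 * real n * real k" using k \<alpha> by (intro mult_mono) auto
    then show ?thesis using k by (simp add: t_def field_simps)
  qed
  define \<A> where "\<A> = {A. A \<subseteq> verts G \<and> connected_in G A \<and> t \<le> card A}"
  have large: "\<alpha> * n \<le> cut_size G U" if U: "U \<subseteq> verts G" "U \<noteq> {}" "2 * card U \<le> n" "t \<le> card U" for U
  proof -
    have "\<alpha> * n \<le> \<rho> * card U" using U(4) \<rho> \<rho>t by (metis mult_left_mono less_imp_le)
    with expand [OF U(1,2)] U show ?thesis by (simp add: n_def \<rho>_def)
  qed
  have "(\<exists>S \<subseteq> verts G. int (card S) \<le> d \<and> (\<forall>A\<in>\<A>. A \<inter> S \<noteq> {})) \<or>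
        (\<exists>U \<subseteq> verts G. \<exists>A\<in>\<A>. \<exists>B\<in>\<A>. A \<subseteq> U \<and> B \<inter> U = {} \<and> int (cut_size G U) \<le> d)"
    unfolding d_def by (rule scramble_alternative) (use fin ne D in \<open>auto simp: \<A>_def\<close>)
  then show False
  proof
    assume "\<exists>S \<subseteq> verts G. int (card S) \<le> d \<and> (\<forall>A\<in>\<A>. A \<inter> S \<noteq> {})"
    then obtain S where 1: "S \<subseteq> verts G" "int (card S) \<le> d" "\<And>A. A \<in> \<A> \<Longrightarrow> A \<inter> S \<noteq> {}"
      by blast
    have S: "real (card S) < \<alpha> * n" using 1(2) d by linarith
    have "\<rho> * card (verts G - S) \<le> cut_size G (verts G - S)"
    proof (rule cut_size_of_small_components [OF fin, where t = t])
      fix X assume X: "X \<subseteq> verts G - S" "X \<noteq> {}" "real (card X) < t"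
      have "\<rho> * card X \<le> \<alpha> * n" using X(3) \<rho> \<rho>t by (metis mult_left_mono less_imp_le)
      moreover have "2 * card X \<le> n" using X(3) t by linarith
      ultimately show "\<rho> * card X \<le> cut_size G X"
        using expand [of X] X by (auto simp: n_def \<rho>_def)
    next
      fix X assume X: "X \<subseteq> verts G - S" "connected_in G X"
      then show "real (card X) < t" using 1(3) [of X] by (force simp: \<A>_def)
    qed auto
    also have "real (cut_size G (verts G - S)) \<le> k * card S"
      using valence [OF 1(1)] by (simp add: cut_size_compl [OF 1(1)] flip: of_nat_mult)
    also have "\<dots> < k * (\<alpha> * n)" using S k by simp
    also have "k * (\<alpha> * n) = \<rho> * ((1 - \<alpha>) * n)" using \<alpha> by (simp add: \<rho>_def)
    finally have "real (card (verts G - S)) < (1 - \<alpha>) * n" using \<rho> by simp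
    moreover have "card (verts G - S) = n - card S" "card S \<le> n"
      using 1(1) fin by (auto simp: n_def card_Diff_subset finite_subset card_mono)
    ultimately show False using S by (simp add: of_nat_diff algebra_simps)
  next
    assume "\<exists>U \<subseteq> verts G. \<exists>A\<in>\<A>. \<exists>B\<in>\<A>. A \<subseteq> U \<and> B \<inter> U = {} \<and> int (cut_size G U) \<le> d"
    then obtain U A B where 2: "U \<subseteq> verts G" "A \<in> \<A>" "B \<in> \<A>" "A \<subseteq> U" "B \<inter> U = {}" "int (cut_size G U) \<le> d"
      by blast
    have sizes: "t \<le> card U" "t \<le> card (verts G - U)"
    proof -
      have "card A \<le> card U" "card B \<le> card (verts G - U)"
        using 2 fin finite_subset [of U "verts G"] by (auto simp: \<A>_def intro!: card_mono)
      then show "t \<le> card U" "t \<le> card (verts G - U)" using 2 by (auto simp: \<A>_def)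
    qed
    have "A \<noteq> {}" "B \<noteq> {}" "B \<subseteq> verts G" using 2(2,3) unfolding \<A>_def connected_in_def by blast+
    with 2 have ne: "U \<noteq> {}" "verts G - U \<noteq> {}" by blast+
    have "card U + card (verts G - U) = n"
      using 2(1) fin by (simp add: n_def card_Diff_subset finite_subset card_mono)
    then consider "2 * card U \<le> n" | "2 * card (verts G - U) \<le> n" by linarith
    then have "\<alpha> * n \<le> cut_size G U"
    proof cases
      case small: 1
      then show ?thesis using large [OF 2(1) ne(1)] sizes(1) by blast
    next
      case small: 2
      then have "\<alpha> * n \<le> cut_size G (verts G - U)" using large [OF Diff_subset ne(2)] sizes(2) by blast
      then show ?thesis by (simp add: cut_size_compl [OF 2(1)])
    qed
    with 2(6) d show False by linarith
  qed
qed

section \<open>Random pairings\<close>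

definition pairings :: "'a set \<Rightarrow> 'a set set set" where
  "pairings W = {P. partition_on W P \<and> (\<forall>p\<in>P. card p = 2)}"

text \<open>
  The pairs that are split by \<open>A\<close>; for \<open>A\<close> the half-edges at a vertex set these are the
  edges that leave the vertex set.
\<close>

definition crossing :: "'a set set \<Rightarrow> 'a set \<Rightarrow> 'a set set" where
  "crossing P A = {p \<in> P. p \<inter> A \<noteq> {} \<and> p - A \<noteq> {}}"

lemma configurations_eq_pairings: "configurations k n = pairings ({1..n} \<times> {1..k})"
proof -
  have "(\<Union>j\<in>{1..n}. cell k j) = {1..n} \<times> {1..k}" by (auto simp: cell_def)
  then show ?thesis by (simp add: configurations_def pairings_def)
qed

lemma finite_pairings: "finite W \<Longrightarrow> finite (pairings W)"
  by (rule finite_subset [of _ "Pow (Pow W)"]) (auto simp: pairings_def partition_on_def)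

lemma finite_pairing: "finite W \<Longrightarrow> P \<in> pairings W \<Longrightarrow> finite P"
  by (auto simp: pairings_def intro: finite_elements)

lemma card_pairing:
  assumes "finite W" "P \<in> pairings W"
  shows "card W = 2 * card P"
proof -
  have P: "partition_on W P" "\<And>p. p \<in> P \<Longrightarrow> card p = 2" using assms by (auto simp: pairings_def)
  have "card W = sum card P"
    using product_partition [OF P(1)] P(2) card.infinite by force
  then show ?thesis using P(2) by simp
qed

lemma pairings_nonempty:
  assumes "finite W" "even (card W)"
  shows "pairings W \<noteq> {}"
  using assms
proof (induction "card W" arbitrary: W rule: less_induct)
  case less
  show ?case
  proof (cases "W = {}")
    case True
    then have "{} \<in> pairings W" by (simp add: pairings_def partition_on_def)
    then show ?thesis by auto
  next
    case False
    then have "card W \<noteq> 0" using less.prems by simp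
    with less.prems have "2 \<le> card W" by presburger
    then obtain p where p: "p \<subseteq> W" "card p = 2" using obtain_subset_with_card_n by metis
    have fp: "finite p" using p less.prems finite_subset by blast
    have c: "card (W - p) = card W - 2" using p fp by (simp add: card_Diff_subset)
    then obtain P where P: "P \<in> pairings (W - p)"
      using less.hyps [of "W - p"] less.prems \<open>2 \<le> card W\<close> by fastforce
    then have "insert p P \<in> pairings W"
      using p by (auto simp: pairings_def partition_on_def disjoint_def)
    then show ?thesis by auto
  qed
qed

lemma sum_Pow_insert:
  assumes "finite W" "a \<notin> W"
  shows "(\<Sum>A\<in>Pow (insert a W). f A) = (\<Sum>A\<in>Pow W. f A + f (insert a A) :: real)"
proof -
  have "(\<Sum>A\<in>Pow (insert a W). f A) = (\<Sum>A\<in>Pow W. f A) + (\<Sum>A\<in>insert a ` Pow W. f A)"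
    unfolding Pow_insert using assms by (intro sum.union_disjoint) auto
  also have "(\<Sum>A\<in>insert a ` Pow W. f A) = (\<Sum>A\<in>Pow W. f (insert a A))"
    using assms by (subst sum.reindex) (auto simp: inj_on_def)
  finally show ?thesis by (simp add: sum.distrib)
qed

text \<open>
  The choices of \<open>A \<inter> p\<close> for the pairs \<open>p\<close> are independent. The empty set contributes \<open>1\<close> to the
  factor of \<open>p\<close>, the two singletons contribute \<open>x w\<close> each, and \<open>p\<close> itself \<open>x\<^sup>2\<close>.
\<close>

lemma crossing_generating_function:
  fixes x w :: real
  assumes "finite P" "disjoint P" "\<And>p. p \<in> P \<Longrightarrow> card p = 2"
  shows "(\<Sum>A\<in>Pow (\<Union>P). x ^ card A * w ^ card (crossing P A)) = (1 + 2 * x * w + x\<^sup>2) ^ card P"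
  using assms
proof (induction P rule: finite_induct)
  case empty
  then show ?case by (simp add: crossing_def)
next
  case (insert p P)
  obtain a b where p: "p = {a, b}" "a \<noteq> b" using insert.prems(2) [of p] by (auto simp: card_2_iff)
  have dis: "disjoint P" and pd: "\<And>q. q \<in> P \<Longrightarrow> p \<inter> q = {}"
    using insert.prems(1) insert.hyps by (auto simp: disjoint_def)
  have "finite q" if "q \<in> P" for q using insert.prems(2) [of q] that card.infinite by fastforce
  then have fin: "finite (\<Union>P)" using insert.hyps by auto
  have ab: "a \<notin> \<Union>P" "b \<notin> \<Union>P" using pd p by blast+
  let ?f = "\<lambda>A. x ^ card A * w ^ card (crossing (insert p P) A)"
  have step: "?f A + ?f (insert a A) + (?f (insert b A) + ?f (insert a (insert b A)))
      = (1 + 2 * x * w + x\<^sup>2) * (x ^ card A * w ^ card (crossing P A))" if A: "A \<subseteq> \<Union>P" for A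
  proof -
    have nab: "a \<notin> A" "b \<notin> A" "finite A" using A ab fin finite_subset by blast+
    have cr: "finite (crossing P A)" "p \<notin> crossing P A" using insert.hyps by (auto simp: crossing_def)
    have "crossing (insert p P) A = crossing P A"
      using nab p by (auto simp: crossing_def)
    moreover have "crossing (insert p P) (insert a A) = insert p (crossing P A)"
      using nab p ab by (auto simp: crossing_def)
    moreover have "crossing (insert p P) (insert b A) = insert p (crossing P A)"
      using nab p ab by (auto simp: crossing_def)
    moreover have "crossing (insert p P) (insert a (insert b A)) = crossing P A"
      using nab p ab by (auto simp: crossing_def)
    ultimately show ?thesis using nab p cr
      by (simp add: algebra_simps power2_eq_square)
  qed
  have "(\<Sum>A\<in>Pow (\<Union>(insert p P)). ?f A) = (\<Sum>A\<in>Pow (insert a (insert b (\<Union>P))). ?f A)"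
    using p by simp
  also have "\<dots> = (\<Sum>A\<in>Pow (insert b (\<Union>P)). ?f A + ?f (insert a A))"
    using fin ab p by (intro sum_Pow_insert) auto
  also have "\<dots> = (\<Sum>A\<in>Pow (\<Union>P). (?f A + ?f (insert a A)) + (?f (insert b A) + ?f (insert a (insert b A))))"
    using fin ab by (intro sum_Pow_insert) auto
  also have "\<dots> = (\<Sum>A\<in>Pow (\<Union>P). (1 + 2 * x * w + x\<^sup>2) * (x ^ card A * w ^ card (crossing P A)))"
    using step by (intro sum.cong) auto
  also have "\<dots> = (1 + 2 * x * w + x\<^sup>2) * (1 + 2 * x * w + x\<^sup>2) ^ card P"
    unfolding sum_distrib_left [symmetric] using insert.IH [OF dis] insert.prems(2) by simp
  finally show ?case using insert.hyps by simp
qed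

lemma crossing_image:
  assumes "inj f"
  shows "card (crossing ((`) f ` P) (f ` A)) = card (crossing P A)"
proof -
  have "f ` p \<inter> f ` A = {} \<longleftrightarrow> p \<inter> A = {}" "f ` p - f ` A = {} \<longleftrightarrow> p - A = {}" for p
    using assms by (simp_all flip: image_Int image_set_diff)
  then have "crossing ((`) f ` P) (f ` A) = (`) f ` crossing P A"
    unfolding crossing_def by blast
  moreover have "inj_on ((`) f) (crossing P A)"
    using assms by (simp add: inj_on_def inj_image_eq_iff)
  ultimately show ?thesis by (simp add: card_image)
qed

lemma pairings_image:
  assumes "inj f" "P \<in> pairings W"
  shows "(`) f ` P \<in> pairings (f ` W)"
proof -
  have P: "partition_on W P" "\<And>p. p \<in> P \<Longrightarrow> card p = 2" using assms by (auto simp: pairings_def)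
  have "inj_on f p" for p using assms(1) inj_on_subset by blast
  then have "\<And>p. p \<in> P \<Longrightarrow> card (f ` p) = 2" using P by (simp add: card_image)
  moreover have "partition_on (f ` W) ((`) f ` P)"
    using P(1) assms(1) by (auto simp: partition_on_def disjoint_def inj_image_eq_iff simp flip: image_Int)
  ultimately show ?thesis by (auto simp: pairings_def)
qed

lemma exists_bijection_moving_subset:
  assumes "finite W" "A \<subseteq> W" "B \<subseteq> W" "card A = card B"
  shows "\<exists>f. inj f \<and> f ` W = W \<and> f ` A = B"
proof -
  have fin: "finite A" "finite B" using assms finite_subset by blast+
  obtain g where g: "bij_betw g A B" using finite_same_card_bij [of A B] assms fin by blast
  have "card (W - A) = card (W - B)" using assms fin by (simp add: card_Diff_subset)
  then obtain h where h: "bij_betw h (W - A) (W - B)"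
    using finite_same_card_bij [of "W - A" "W - B"] assms(1) by blast
  define f where "f x = (if x \<in> A then g x else if x \<in> W then h x else x)" for x
  have "bij_betw f A B \<longleftrightarrow> bij_betw g A B" by (rule bij_betw_cong) (simp add: f_def)
  with g have fA: "bij_betw f A B" by simp
  have "bij_betw f (W - A) (W - B) \<longleftrightarrow> bij_betw h (W - A) (W - B)"
    by (rule bij_betw_cong) (simp add: f_def)
  with h have fWA: "bij_betw f (W - A) (W - B)" by simp
  then have fW: "bij_betw f W W"
    using bij_betw_combine [OF fA fWA] assms by (simp add: Un_absorb1)
  have "bij_betw f (- W) (- W) \<longleftrightarrow> bij_betw id (- W) (- W)"
    by (rule bij_betw_cong) (use assms in \<open>auto simp: f_def\<close>)
  then have "bij_betw f (- W) (- W)" by simp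
  with fW have "bij_betw f (W \<union> - W) (W \<union> - W)" by (rule bij_betw_combine) auto
  then have "inj f" by (simp add: bij_betw_def)
  with fA fW show ?thesis by (auto simp: bij_betw_def)
qed

text \<open>
  A bijection of \<open>W\<close> that moves \<open>A\<close> to \<open>B\<close> permutes the pairings. By exchanging \<open>A\<close> and \<open>B\<close> one
  gets equality.
\<close>

lemma crossing_weight_le_of_card_eq:
  fixes w :: real
  assumes "finite W" "A \<subseteq> W" "B \<subseteq> W" "card A = card B" "0 \<le> w"
  shows "(\<Sum>P\<in>pairings W. w ^ card (crossing P A)) \<le> (\<Sum>P\<in>pairings W. w ^ card (crossing P B))"
proof -
  obtain f where f: "inj f" "f ` W = W" "f ` A = B"
    using exists_bijection_moving_subset [OF assms(1-4)] by blast
  have inj: "inj ((`) ((`) f))" using f(1) by (simp add: inj_image_eq_iff inj_def)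
  have "(\<Sum>P\<in>pairings W. w ^ card (crossing P A)) = (\<Sum>P\<in>pairings W. w ^ card (crossing ((`) f ` P) B))"
    using crossing_image [OF f(1), of _ A] f(3) by simp
  also have "\<dots> = (\<Sum>P\<in>(`) ((`) f) ` pairings W. w ^ card (crossing P B))"
    using inj by (subst sum.reindex) (auto intro: inj_on_subset)
  also have "\<dots> \<le> (\<Sum>P\<in>pairings W. w ^ card (crossing P B))"
    using pairings_image [OF f(1), of _ W] f(2) assms by (intro sum_mono2) (auto simp: finite_pairings)
  finally show ?thesis .
qed

text \<open>
  Double counting: the left side is the sum of \<open>x ^ card B * w ^ card (crossing P B)\<close> over all
  pairings \<open>P\<close> and all \<open>B\<close> of the same cardinality as \<open>A\<close>. For a fixed \<open>P\<close> these \<open>B\<close>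
  give a part of the generating function.
\<close>

lemma crossing_weight_bound:
  fixes x w :: real
  assumes W: "finite W" "A \<subseteq> W" and x: "0 < x" and w: "0 \<le> w"
  shows "(\<Sum>P\<in>pairings W. w ^ card (crossing P A)) * (x ^ card A * real (card W choose card A))
    \<le> card (pairings W) * (1 + 2 * x * w + x\<^sup>2) ^ (card W div 2)"
proof -
  let ?S = "{B. B \<subseteq> W \<and> card B = card A}"
  have finS: "finite ?S" by (rule finite_subset [of _ "Pow W"]) (use W in auto)
  have "(\<Sum>P\<in>pairings W. w ^ card (crossing P A)) * (x ^ card A * real (card W choose card A))
    = (\<Sum>B\<in>?S. x ^ card A * (\<Sum>P\<in>pairings W. w ^ card (crossing P A)))"
    using n_subsets [OF W(1)] by simp
  also have "\<dots> \<le> (\<Sum>B\<in>?S. x ^ card B * (\<Sum>P\<in>pairings W. w ^ card (crossing P B)))"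
    using W x w by (intro sum_mono) (auto intro!: mult_left_mono crossing_weight_le_of_card_eq)
  also have "\<dots> = (\<Sum>P\<in>pairings W. \<Sum>B\<in>?S. x ^ card B * w ^ card (crossing P B))"
    by (subst sum.swap) (simp add: sum_distrib_left)
  also have "\<dots> \<le> (\<Sum>P\<in>pairings W. (1 + 2 * x * w + x\<^sup>2) ^ (card W div 2))"
  proof (rule sum_mono)
    fix P assume P: "P \<in> pairings W"
    have P': "disjoint P" "\<Union>P = W" "\<And>p. p \<in> P \<Longrightarrow> card p = 2"
      using P by (auto simp: pairings_def partition_on_def)
    have "(\<Sum>B\<in>?S. x ^ card B * w ^ card (crossing P B)) \<le> (\<Sum>B\<in>Pow (\<Union>P). x ^ card B * w ^ card (crossing P B))"
      using P' W x w by (intro sum_mono2) auto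
    also have "\<dots> = (1 + 2 * x * w + x\<^sup>2) ^ card P"
      using P' finite_pairing [OF W(1) P] by (intro crossing_generating_function) auto
    also have "card P = card W div 2" using card_pairing [OF W(1) P] by simp
    finally show "(\<Sum>B\<in>?S. x ^ card B * w ^ card (crossing P B)) \<le> (1 + 2 * x * w + x\<^sup>2) ^ (card W div 2)" .
  qed
  finally show ?thesis by simp
qed

text \<open>
  Choosing \<open>s\<close> elements in each of \<open>k\<close> blocks of size \<open>n\<close> is one way of choosing \<open>k s\<close> elements.
\<close>

lemma choose_power_le: "(n choose s) ^ k \<le> (k * n) choose (k * s)"
proof (induction k)
  case 0
  then show ?case by simp
next
  case (Suc k)
  have "(n choose s) ^ Suc k \<le> (n choose s) * (k * n choose (k * s))" using Suc by simp
  also have "\<dots> \<le> (\<Sum>j\<le>s + k * s. (n choose j) * (k * n choose (s + k * s - j)))"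
    using member_le_sum [of s "{..s + k * s}" "\<lambda>j. (n choose j) * (k * n choose (s + k * s - j))"] by simp
  also have "\<dots> = (n + k * n) choose (s + k * s)" by (rule vandermonde)
  finally show ?case by simp
qed

text \<open>
  Markov's inequality for \<open>w ^ card (crossing P (U \<times> {1..k}))\<close> and a union bound over the
  \<open>n choose s\<close> sets \<open>U\<close>. One of the \<open>k\<close> factors \<open>n choose s\<close> gained from the
  averaging is spent on the union bound.
\<close>

lemma small_crossing_probability:
  fixes x w \<gamma> :: real
  assumes even: "even (k * n)" and x: "0 < x" and w: "0 < w" "w \<le> 1" and s: "s \<le> n" and k: "1 \<le> k"
  shows "measure_pmf.prob (pmf_of_set (configurations k n))
     {P. \<exists>U \<subseteq> {1..n}. card U = s \<and> card (crossing P (U \<times> {1..k})) < \<gamma>}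
   \<le> (1 + 2 * x * w + x\<^sup>2) ^ (k * n div 2) / (x ^ (k * s) * w powr \<gamma> * real (n choose s) ^ (k - 1))"
proof -
  let ?W = "{1..n} \<times> {1..k}"
  let ?C = "configurations k n"
  let ?S = "{U. U \<subseteq> {1..n} \<and> card U = s}"
  let ?E = "(1 + 2 * x * w + x\<^sup>2) ^ (k * n div 2)"
  let ?B = "\<lambda>U. {P \<in> ?C. card (crossing P (U \<times> {1..k})) < \<gamma>}"
  have cW: "card ?W = k * n" by (simp add: card_cartesian_product)
  have finC: "finite ?C" by (simp add: configurations_eq_pairings finite_pairings)
  have neC: "?C \<noteq> {}" unfolding configurations_eq_pairings by (rule pairings_nonempty) (use even cW in auto)
  have finS: "finite ?S" by (rule finite_subset [of _ "Pow {1..n}"]) auto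
  have cS: "card ?S = n choose s" using n_subsets [of "{1..n}" s] by simp
  have choose_pos: "real (n choose s) > 0" using s by simp
  have E: "?E > 0" using x w by (intro zero_less_power add_pos_pos) auto
  have one: "card (?B U) \<le> card ?C * (?E / (x ^ (k * s) * w powr \<gamma> * real (n choose s) ^ k))"
    if U: "U \<in> ?S" for U
  proof -
    have cA: "card (U \<times> {1..k}) = k * s" using U by (simp add: card_cartesian_product)
    have "w powr \<gamma> * card (?B U) = (\<Sum>P\<in>?B U. w powr \<gamma>)" by simp
    also have "\<dots> \<le> (\<Sum>P\<in>?B U. w ^ card (crossing P (U \<times> {1..k})))"
      using w by (intro sum_mono) (auto simp flip: powr_realpow intro: powr_mono')
    also have "\<dots> \<le> (\<Sum>P\<in>?C. w ^ card (crossing P (U \<times> {1..k})))"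
      using finC w by (intro sum_mono2) auto
    finally have 1: "w powr \<gamma> * card (?B U) \<le> (\<Sum>P\<in>?C. w ^ card (crossing P (U \<times> {1..k})))" .
    have "w powr \<gamma> * card (?B U) * (x ^ (k * s) * real (n choose s) ^ k)
      \<le> (\<Sum>P\<in>?C. w ^ card (crossing P (U \<times> {1..k}))) * (x ^ (k * s) * real ((k * n) choose (k * s)))"
      using x w choose_power_le [of n s k]
      by (intro mult_mono [OF 1] mult_left_mono) (auto intro!: sum_nonneg simp flip: of_nat_power)
    also have "\<dots> \<le> card ?C * ?E"
    proof -
      have "U \<times> {1..k} \<subseteq> ?W" using U by blast
      from crossing_weight_bound [OF _ this x, of w] w show ?thesis
        unfolding cW cA configurations_eq_pairings by simp
    qed
    finally show ?thesis using x w choose_pos by (simp add: field_simps)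
  qed
  have "card (?C \<inter> {P. \<exists>U \<subseteq> {1..n}. card U = s \<and> card (crossing P (U \<times> {1..k})) < \<gamma>}) \<le> card (\<Union>U\<in>?S. ?B U)"
    using finC finS by (intro card_mono) auto
  also have "\<dots> \<le> (\<Sum>U\<in>?S. card (?B U))" using finS by (rule card_UN_le)
  finally have "real (card (?C \<inter> {P. \<exists>U \<subseteq> {1..n}. card U = s \<and> card (crossing P (U \<times> {1..k})) < \<gamma>}))
      \<le> (\<Sum>U\<in>?S. real (card (?B U)))" by (simp flip: of_nat_sum)
  also have "\<dots> \<le> (\<Sum>U\<in>?S. card ?C * (?E / (x ^ (k * s) * w powr \<gamma> * real (n choose s) ^ k)))"
    by (rule sum_mono) (rule one)
  also have "\<dots> = card ?C * (?E / (x ^ (k * s) * w powr \<gamma> * real (n choose s) ^ (k - 1)))"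
    using k choose_pos cS by (cases k) (auto simp: field_simps)
  finally show ?thesis
    using finC neC by (simp add: measure_pmf_of_set field_simps card_gt_0_iff)
qed

text \<open>
  Loops never leave a vertex set, and every other edge that does has exactly one end in it, so the
  double sum over \<open>u \<in> U\<close> and \<open>w \<notin> U\<close> counts each split pair once.
\<close>

lemma cut_size_config_graph:
  assumes P: "P \<in> configurations k n" and U: "U \<subseteq> {1..n}"
  shows "cut_size (config_graph n P) U = card (crossing P (U \<times> {1..k}))"
proof -
  have P': "partition_on ({1..n} \<times> {1..k}) P" "\<And>p. p \<in> P \<Longrightarrow> card p = 2"
    using P by (auto simp: configurations_eq_pairings pairings_def)
  have finP: "finite P" using P by (auto simp: configurations_eq_pairings intro: finite_pairing [rotated])
  have finU: "finite U" using U finite_subset by blast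
  let ?e = "\<lambda>u w. {p \<in> P. fst ` p = {u, w}}"
  have split: "(\<exists>u\<in>U. \<exists>w\<in>N - U. {a, b} = {u, w}) \<longleftrightarrow> a \<in> U \<and> b \<notin> U \<or> b \<in> U \<and> a \<notin> U"
    if "a \<in> N" "b \<in> N" for a b N
  proof
    assume "a \<in> U \<and> b \<notin> U \<or> b \<in> U \<and> a \<notin> U"
    then show "\<exists>u\<in>U. \<exists>w\<in>N - U. {a, b} = {u, w}"
      using that by (elim disjE) (rule bexI [of _ a] bexI [of _ b], rule bexI [of _ b] bexI [of _ a], auto)+
  qed (auto simp: doubleton_eq_iff)
  have "cut_size (config_graph n P) U = (\<Sum>(u, w)\<in>U \<times> ({1..n} - U). card (?e u w))"
    using finU by (simp add: cut_size_def config_graph_def edge_mult_def sum.cartesian_product)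
  also have "\<dots> = card (\<Union>(u, w)\<in>U \<times> ({1..n} - U). ?e u w)"
    using finU finP by (subst card_UN_disjoint) (auto simp: case_prod_beta doubleton_eq_iff)
  also have "(\<Union>(u, w)\<in>U \<times> ({1..n} - U). ?e u w) = crossing P (U \<times> {1..k})" (is "?L = ?R")
  proof (intro set_eqI)
    fix p
    show "p \<in> ?L \<longleftrightarrow> p \<in> ?R"
    proof (cases "p \<in> P")
      case True
      then have sub: "p \<subseteq> {1..n} \<times> {1..k}" using P' by (auto simp: partition_on_def)
      obtain a b where p: "p = {a, b}" using P'(2) [OF True] by (auto simp: card_2_iff)
      obtain a1 a2 b1 b2 where ab: "a = (a1, a2)" "b = (b1, b2)" by (metis surj_pair)
      have "a1 \<in> {1..n}" "b1 \<in> {1..n}" "a2 \<in> {1..k}" "b2 \<in> {1..k}" using sub by (auto simp: p ab)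
      have "p \<in> ?L \<longleftrightarrow> (\<exists>u\<in>U. \<exists>w\<in>{1..n} - U. {a1, b1} = {u, w})"
        using True unfolding p ab by simp
      also have "\<dots> \<longleftrightarrow> a1 \<in> U \<and> b1 \<notin> U \<or> b1 \<in> U \<and> a1 \<notin> U"
        by (rule split) fact+
      also have "\<dots> \<longleftrightarrow> p \<in> ?R"
        using True \<open>a2 \<in> {1..k}\<close> \<open>b2 \<in> {1..k}\<close> unfolding p ab crossing_def by auto
      finally show ?thesis .
    qed (auto simp: crossing_def)
  qed
  finally show ?thesis .
qed

lemma card_crossing_le:
  assumes "finite A" "disjoint P"
  shows "card (crossing P A) \<le> card A"
proof -
  have "\<exists>a. a \<in> p \<inter> A" if "p \<in> crossing P A" for p using that by (auto simp: crossing_def)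
  then obtain f where f: "\<And>p. p \<in> crossing P A \<Longrightarrow> f p \<in> p \<inter> A" by metis
  have "inj_on f (crossing P A)"
  proof (rule inj_onI)
    fix p q assume pq: "p \<in> crossing P A" "q \<in> crossing P A" "f p = f q"
    then have "f p \<in> p \<inter> q" using f [of p] f [of q] by auto
    then show "p = q" using pq assms(2) by (auto simp: crossing_def disjoint_def)
  qed
  moreover have "f ` crossing P A \<subseteq> A" using f by auto
  ultimately show ?thesis using assms(1) card_inj_on_le by blast
qed

section \<open>The entropy form of the first moment bound\<close>

text \<open>
  \<open>n\<close> times the entropy of \<open>s / n\<close>, in a form without quotients inside the logarithms.
\<close>

definition xlogx_entropy :: "real \<Rightarrow> real \<Rightarrow> real" where
  "xlogx_entropy n s = n * ln n - s * ln s - (n - s) * ln (n - s)"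

text \<open>
  Stirling's upper bound up to a factor of order \<open>sqrt n\<close>. The increment from \<open>n\<close> to \<open>Suc n\<close> reduces
  to \<open>(n + 1) (ln (n + 1) - ln n) \<ge> 1\<close>.
\<close>

lemma ln_fact_le:
  assumes "1 \<le> n"
  shows "ln (fact n) \<le> real n * ln n - n + 1 + ln n"
  using assms
proof (induction n rule: nat_induct_at_least)
  case base
  then show ?case by simp
next
  case (Suc n)
  have n: "real n > 0" using Suc by simp
  have "ln (real n / (n + 1)) \<le> real n / (n + 1) - 1" using n by (intro ln_le_minus_one) simp
  then have "ln n - ln (real n + 1) \<le> - 1 / (n + 1)" using n by (simp add: ln_div field_simps)
  then have "(n + 1) * (ln n - ln (real n + 1)) \<le> (n + 1) * (- 1 / (n + 1))"
    using n by (intro mult_left_mono) auto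
  then have "(n + 1) * ln n \<le> (n + 1) * ln (real n + 1) - 1" using n by (simp add: algebra_simps)
  moreover have "ln (fact (Suc n) :: real) = ln (n + 1) + ln (fact n)"
    by (simp add: ln_mult add.commute)
  ultimately show ?case using Suc.IH by (simp add: algebra_simps)
qed

text \<open>
  The matching comparison between two factorials: Stirling's quotient \<open>n! exp n / n ^ n\<close> increases,
  because \<open>n (ln (n + 1) - ln n) \<le> 1\<close>. Being relative, it loses no factor depending on \<open>n\<close>.
\<close>

lemma ln_fact_minus_xlogx_mono:
  assumes "1 \<le> m" "m \<le> n"
  shows "ln (fact m) - (real m * ln m - m) \<le> ln (fact n) - (real n * ln n - n)"
  using assms(2)
proof (induction n rule: dec_induct)
  case base
  then show ?case by simp
next
  case (step n)
  have n: "real n > 0" using step assms by simp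
  have "ln ((real n + 1) / n) \<le> (real n + 1) / n - 1" using n by (intro ln_le_minus_one) simp
  then have "ln (real n + 1) - ln n \<le> 1 / n" using n by (simp add: ln_div field_simps)
  then have "n * (ln (real n + 1) - ln n) \<le> n * (1 / n)" using n by (intro mult_left_mono) auto
  then have "n * ln (real n + 1) \<le> n * ln n + 1" using n by (simp add: algebra_simps)
  moreover have "ln (fact (Suc n) :: real) = ln (n + 1) + ln (fact n)"
    by (simp add: ln_mult add.commute)
  ultimately show ?case using step.IH by (simp add: algebra_simps)
qed

text \<open>
  The loss is a factor linear in \<open>s\<close> and not in \<open>n\<close>. This matters for small \<open>s\<close>, where
  the bound on the probability decays only like a small negative power of \<open>n\<close>.
\<close>

lemma ln_choose_ge:
  assumes "1 \<le> s" "s < n"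
  shows "xlogx_entropy n s - 1 - ln s \<le> ln (n choose s)"
proof -
  have "real (n choose s) = fact n / (fact s * fact (n - s))"
    using assms by (intro binomial_fact) simp
  then have "ln (n choose s) = ln (fact n) - ln (fact s) - ln (fact (n - s))"
    by (simp add: ln_div ln_mult)
  moreover have "1 \<le> n - s" "real (n - s) = real n - s" using assms by auto
  ultimately show ?thesis
    using ln_fact_le [OF assms(1)] ln_fact_minus_xlogx_mono [of "n - s" n]
    by (simp add: xlogx_entropy_def)
qed

lemma sqrt_divide_mult:
  assumes "0 < a" "0 < (b :: real)"
  shows "sqrt (a / b) * b = sqrt (a * b)" "sqrt (a / b) * sqrt (a * b) = a"
proof -
  have "sqrt (a / b) * b = sqrt (a / b) * sqrt b * sqrt b" using assms by simp
  also have "sqrt (a / b) * sqrt b = sqrt a" using assms by (simp flip: real_sqrt_mult)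
  finally show *: "sqrt (a / b) * b = sqrt (a * b)" by (simp add: real_sqrt_mult)
  have "sqrt (a / b) * sqrt (a * b) = sqrt (a * a)"
    unfolding real_sqrt_mult [symmetric] using assms by (intro arg_cong [of _ _ sqrt]) simp
  then show "sqrt (a / b) * sqrt (a * b) = a" using assms by simp
qed

text \<open>
  The case \<open>k = 3\<close> with \<open>x\<^sup>2 = s / (n - s)\<close>, the optimal choice when \<open>w\<close> is small. Then
  \<open>1 + x\<^sup>2 = n / (n - s)\<close>, and the powers of \<open>1 + x\<^sup>2\<close> and \<open>x\<close> combine to \<open>3/2\<close> of the entropy,
  against which the two remaining binomial coefficients contribute \<open>-2\<close> times the entropy.
\<close>

lemma small_crossing_probability_entropy:
  fixes w \<gamma> :: real
  assumes even: "even n" and s: "1 \<le> s" "s < n" and w: "0 < w" "w \<le> 1"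
  shows "measure_pmf.prob (pmf_of_set (configurations 3 n))
     {P. \<exists>U \<subseteq> {1..n}. card U = s \<and> card (crossing P (U \<times> {1..3})) < \<gamma>}
   \<le> exp 2 * real s ^ 2 * exp (- xlogx_entropy n s / 2 + 3 * w * sqrt (s * (real n - s)) - \<gamma> * ln w)"
proof -
  define x where "x = sqrt (s / (real n - s))"
  define m where "m = 3 * n div 2"
  have ns: "real n - s > 0" "real s > 0" "real n > 0" using s by auto
  have x: "x > 0" using ns by (simp add: x_def)
  have x2: "x\<^sup>2 = s / (real n - s)" using ns by (simp add: x_def)
  have m: "real m = 3 * n / 2" using even by (auto simp: m_def elim!: evenE)
  have lnx: "ln x = (ln s - ln (real n - s)) / 2" using ns by (simp add: x_def ln_sqrt ln_div)
  have xs: "x * (real n - s) = sqrt (s * (real n - s))"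
    using ns by (simp add: x_def sqrt_divide_mult)
  let ?F = "1 + 2 * x * w + x\<^sup>2"
  let ?z = "2 * w * sqrt (s * (real n - s)) / n"
  have z: "?z \<ge> 0" using ns w by simp
  have F: "?F = n / (real n - s) * (1 + ?z)"
    unfolding x2 xs [symmetric] using ns by (simp add: field_simps)
  have Fpos: "?F > 0" using x w by (intro add_pos_pos) auto
  have lnF: "ln ?F \<le> ln n - ln (real n - s) + ?z"
    unfolding F using ns z ln_add_one_self_le_self [OF z] by (simp add: ln_mult ln_div)
  have mF: "m * ln ?F \<le> 3 / 2 * (n * ln n - n * ln (real n - s)) + 3 * w * sqrt (s * (real n - s))"
  proof -
    have "m * ln ?F \<le> m * (ln n - ln (real n - s) + ?z)" using lnF by (intro mult_left_mono) auto
    also have "\<dots> = 3 / 2 * (n * ln n - n * ln (real n - s)) + 3 * w * sqrt (s * (real n - s))"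
      unfolding m using ns by (simp add: field_simps)
    finally show ?thesis .
  qed
  have C: "real (n choose s) > 0" using s by simp
  let ?B = "?F ^ m / (x ^ (3 * s) * w powr \<gamma> * real (n choose s) ^ (3 - 1))"
  have "ln ?B = m * ln ?F - 3 * s * ln x - \<gamma> * ln w - 2 * ln (n choose s)"
    using Fpos x w C by (simp add: ln_div ln_mult ln_realpow ln_powr)
  also have "\<dots> \<le> 3 / 2 * (n * ln n - n * ln (real n - s)) + 3 * w * sqrt (s * (real n - s))
      - 3 * s * ln x - \<gamma> * ln w - 2 * (xlogx_entropy n s - 1 - ln s)"
    by (intro diff_mono mF order_refl mult_left_mono ln_choose_ge [OF s]) simp
  also have "\<dots> = 2 + 2 * ln s + (- xlogx_entropy n s / 2 + 3 * w * sqrt (s * (real n - s)) - \<gamma> * ln w)"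
    unfolding lnx xlogx_entropy_def by (simp add: field_simps)
  also have "\<dots> = ln (exp 2 * real s ^ 2 * exp (- xlogx_entropy n s / 2 + 3 * w * sqrt (s * (real n - s)) - \<gamma> * ln w))"
    using ns by (simp add: ln_mult ln_realpow)
  finally have "?B \<le> exp 2 * real s ^ 2 * exp (- xlogx_entropy n s / 2 + 3 * w * sqrt (s * (real n - s)) - \<gamma> * ln w)"
    using Fpos x w C ns by (subst (asm) ln_le_cancel_iff) (auto intro!: mult_pos_pos divide_pos_pos)
  moreover have "measure_pmf.prob (pmf_of_set (configurations 3 n))
     {P. \<exists>U \<subseteq> {1..n}. card U = s \<and> card (crossing P (U \<times> {1..3})) < \<gamma>} \<le> ?B"
    unfolding m_def using small_crossing_probability [of 3 n x w s \<gamma>] even x w s by simp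
  ultimately show ?thesis by linarith
qed

section \<open>Negativity of the exponent\<close>

lemma minus_ln_one_minus_ge:
  fixes u :: real
  assumes "0 \<le> u" "u < 1"
  shows "u + u\<^sup>2 / 2 \<le> - ln (1 - u)"
proof -
  let ?g = "\<lambda>u. - ln (1 - u) - u - u\<^sup>2 / 2 :: real"
  have "?g 0 \<le> ?g u"
  proof (rule DERIV_nonneg_imp_nondecreasing [OF assms(1)])
    fix v :: real assume v: "0 \<le> v" "v \<le> u"
    then have "v < 1" using assms by simp
    then have "(?g has_real_derivative (1 / (1 - v) - 1 - v)) (at v)"
      by (auto intro!: derivative_eq_intros)
    moreover have "1 / (1 - v) - 1 - v = v\<^sup>2 / (1 - v)"
      using \<open>v < 1\<close> by (simp add: field_simps power2_eq_square)
    ultimately show "\<exists>y. (?g has_real_derivative y) (at v) \<and> 0 \<le> y" using \<open>v < 1\<close> by force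
  qed
  then show ?thesis by simp
qed

lemma ln_375_over_116_ge: "1.16 \<le> ln (375 / 116 :: real)"
proof -
  \<comment> \<open>\<open>375 / 116\<close> is \<open>3.2327\<close>; the upper bound for the exponential is below \<open>3.225\<close>.\<close>
  have "exp (1.16 :: real) = exp 1 * exp 0.16" by (simp flip: exp_add)
  also have "\<dots> \<le> 2.72 * (1 + 0.16 + 0.16\<^sup>2)"
    using e_less_272 exp_bound [of "0.16 :: real"] by (intro mult_mono) auto
  also have "\<dots> \<le> 375 / 116" by (simp add: power2_eq_square)
  finally show ?thesis by (subst ln_ge_iff) auto
qed

lemma ln_116_over_9_le: "ln (116 / 9 :: real) \<le> 2.584"
proof -
  \<comment> \<open>\<open>116 / 9\<close> is \<open>12.9\<close>, close to the power \<open>16\<close> of \<open>2\<close>.\<close>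
  have "ln (116 / 9 :: real) = ln (2 ^ 4) + ln (116 / 144)" by (subst ln_mult_pos [symmetric]) auto
  also have "\<dots> = 4 * ln 2 + ln (116 / 144 :: real)" by (subst ln_realpow) auto
  also have "\<dots> \<le> 4 * (25 / 36) + (116 / 144 - 1)"
    using ln2_le_25_over_36 ln_le_minus_one [of "116 / 144 :: real"] by simp
  finally show ?thesis by simp
qed

lemma ln_125_over_6_le: "ln (125 / 6 :: real) \<le> 3.08"
proof -
  have "ln (125 / 6 :: real) = ln (2 ^ 4) + ln (125 / 96)" by (subst ln_mult_pos [symmetric]) auto
  also have "\<dots> = 4 * ln 2 + ln (125 / 96 :: real)" by (subst ln_realpow) auto
  also have "\<dots> \<le> 4 * (25 / 36) + (125 / 96 - 1)"
    using ln2_le_25_over_36 ln_le_minus_one [of "125 / 96 :: real"] by simp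
  finally show ?thesis by simp
qed

definition binary_entropy :: "real \<Rightarrow> real" where
  "binary_entropy u = - u * ln u - (1 - u) * ln (1 - u)"

lemma xlogx_entropy_eq:
  assumes "0 < s" "s < n"
  shows "xlogx_entropy n s = n * binary_entropy (s / n)"
proof -
  have "1 - s / n = (n - s) / n" using assms by (simp add: field_simps)
  then have "ln (1 - s / n) = ln (n - s) - ln n" using assms by (simp add: ln_div)
  then show ?thesis using assms
    by (simp add: xlogx_entropy_def binary_entropy_def ln_div field_simps)
qed

lemma binary_entropy_mono:
  assumes "0 < u" "u \<le> v" "v \<le> 1 / 2"
  shows "binary_entropy u \<le> binary_entropy v"
proof (rule DERIV_nonneg_imp_nondecreasing [OF assms(2)])
  fix t assume t: "u \<le> t" "t \<le> v"
  then have t': "0 < t" "t \<le> 1 / 2" "0 < 1 - t" using assms by auto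
  then have "(binary_entropy has_real_derivative (ln (1 - t) - ln t)) (at t)"
    unfolding binary_entropy_def [abs_def] by (auto intro!: derivative_eq_intros)
  moreover have "ln t \<le> ln (1 - t)" using t' by simp
  ultimately show "\<exists>y. (binary_entropy has_real_derivative y) (at t) \<and> 0 \<le> y" by force
qed

text \<open>
  Sets with \<open>s \<le> (116 / 375) n\<close>, where \<open>\<gamma> = \<rho> s\<close> with \<open>\<rho> = 27 / 116\<close>. The value of \<open>w\<close>
  minimizes the exponent: it makes the middle term equal to \<open>\<gamma>\<close>. Divided by \<open>s\<close>, the
  exponent depends only on \<open>u = s / n\<close> and increases with \<open>u\<close>, so the breakpoint \<open>116 / 375\<close> is
  critical; there it is about \<open>-0.08\<close>. The logarithmic term, with \<open>89 / 232 = (1 - \<rho>) / 2\<close>, is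
  kept because it makes the bound decay in \<open>n\<close> for each fixed \<open>s\<close>.
\<close>

lemma small_set_exponent:
  fixes n s :: real
  assumes s: "0 < s" and sn: "s \<le> 116 / 375 * n"
  defines "w \<equiv> 9 / 116 * sqrt (s / (n - s))"
  shows "- xlogx_entropy n s / 2 + 3 * w * sqrt (s * (n - s)) - 27 / 116 * s * ln w
    \<le> - s / 50 - 89 / 232 * s * (ln n - ln s - ln (375 / 116))"
proof -
  define u where "u = s / n"
  define L where "L = - ln u"
  have n: "n > 0" "s < n" using s sn by auto
  have u: "0 < u" "u \<le> 116 / 375" "u < 1" using s sn n by (auto simp: u_def field_simps)
  have ns: "n - s > 0" using n by simp
  have lns: "ln s = ln n - L" using s n by (simp add: L_def u_def ln_div)
  have "n - s = n * (1 - u)" using n by (simp add: u_def field_simps)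
  then have lnns: "ln (n - s) = ln n + ln (1 - u)" using n u by (simp add: ln_mult)
  define K where "K = (1 - u) / u * (- ln (1 - u))"
  have W: "3 * w * sqrt (s * (n - s)) = 27 / 116 * s"
    using sqrt_divide_mult(2) [OF s ns] by (simp add: w_def)
  have "ln w = - ln (116 / 9) + (ln s - ln (n - s)) / 2"
    using s ns by (simp add: w_def ln_mult ln_sqrt ln_div)
  then have lnw: "ln w = - ln (116 / 9) + (- L - ln (1 - u)) / 2" unfolding lns lnns by simp
  have "n - s = s * ((1 - u) / u)" using s n by (simp add: u_def field_simps)
  then have "(n - s) * ln (1 - u) = - s * K" by (simp add: K_def)
  moreover have "xlogx_entropy n s = s * L - (n - s) * ln (1 - u)"
    unfolding xlogx_entropy_def lns lnns by (simp add: algebra_simps)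
  ultimately have H: "xlogx_entropy n s = s * (L + K)" by (simp add: algebra_simps)
  have E: "- xlogx_entropy n s / 2 + 3 * w * sqrt (s * (n - s)) - 27 / 116 * s * ln w
    = s * (- (L + K) / 2 + 27 / 116 + 27 / 116 * ln (116 / 9) + 27 / 232 * (L + ln (1 - u)))"
    unfolding H W lnw by (simp add: field_simps)
  have l: "u + u\<^sup>2 / 2 \<le> - ln (1 - u)" using minus_ln_one_minus_ge u by auto
  have "1 - u / 2 - u\<^sup>2 / 2 = (1 - u) / u * (u + u\<^sup>2 / 2)"
    using u by (simp add: field_simps power2_eq_square)
  also have "\<dots> \<le> K"
    unfolding K_def using l u by (intro mult_left_mono) auto
  finally have "1 - u / 2 - u\<^sup>2 / 2 \<le> K" .
  moreover have "u\<^sup>2 \<le> 116 / 375 * u" using u by (simp add: power2_eq_square)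
  moreover have "u \<le> - ln (1 - u)" using l zero_le_power2 [of u] by linarith
  ultimately have "- (L + K) / 2 + 27 / 116 + 27 / 116 * ln (116 / 9)
       + 27 / 232 * (L + ln (1 - u)) \<le> - 1 / 50 - 89 / 232 * (L - ln (375 / 116))"
    using u(2) ln_375_over_116_ge ln_116_over_9_le by (simp add: field_simps)
  then have "s * (- (L + K) / 2 + 27 / 116 + 27 / 116 * ln (116 / 9)
       + 27 / 232 * (L + ln (1 - u))) \<le> s * (- 1 / 50 - 89 / 232 * (L - ln (375 / 116)))"
    using s by (intro mult_left_mono) auto
  then show ?thesis unfolding E lns by (simp add: algebra_simps)
qed

text \<open>
  Sets with \<open>(116 / 375) n \<le> s \<le> n / 2\<close>, where \<open>\<gamma> = 9 n / 125\<close>. Here \<open>w = 6 / 125\<close> is optimal for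
  \<open>s = n / 2\<close>, and \<open>sqrt (s (n - s)) \<le> n / 2\<close> throughout. The entropy is at least its value
  at the breakpoint, about \<open>0.62\<close>, and exceeds twice the other terms, about \<open>0.58\<close>.
\<close>

lemma large_set_exponent:
  fixes n s :: real
  assumes n: "0 < n" and s: "116 / 375 * n \<le> s" "s \<le> n / 2"
  shows "- xlogx_entropy n s / 2 + 3 * (6 / 125) * sqrt (s * (n - s)) - 9 / 125 * n * ln (6 / 125)
    \<le> - n / 200"
proof -
  define u where "u = s / n"
  have u: "116 / 375 \<le> u" "u \<le> 1 / 2" using s n by (auto simp: u_def field_simps)
  have sn: "0 < s" "s < n" using s n by linarith+
  have "ln (116 / 375 :: real) = - ln (375 / 116)" by (simp add: ln_div)
  then have "0.6 \<le> binary_entropy (116 / 375)"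
    using ln_375_over_116_ge minus_ln_one_minus_ge [of "116 / 375"]
    by (simp add: binary_entropy_def power2_eq_square field_simps)
  also have "\<dots> \<le> binary_entropy u" using u by (intro binary_entropy_mono) auto
  finally have "n * 0.6 \<le> n * binary_entropy u" using n by (intro mult_left_mono) auto
  also have "\<dots> = xlogx_entropy n s" using xlogx_entropy_eq sn by (simp add: u_def)
  finally have H: "n * 0.6 \<le> xlogx_entropy n s" .
  define q where "q = sqrt (s * (n - s))"
  define l where "l = n * ln (125 / 6)"
  have "q \<le> (s + (n - s)) / 2" unfolding q_def using sn by (intro arith_geo_mean_sqrt) auto
  moreover have "l \<le> n * 3.08"
    unfolding l_def using n ln_125_over_6_le by (intro mult_left_mono) auto
  ultimately have "- xlogx_entropy n s / 2 + 3 * (6 / 125) * q + 9 / 125 * l \<le> - n / 200"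
    using H n by simp
  moreover have "9 / 125 * n * ln (6 / 125 :: real) = - (9 / 125 * l)"
    unfolding l_def using ln_inverse [of "125 / 6 :: real"] by simp
  ultimately show ?thesis unfolding q_def by linarith
qed

section \<open>Expansion of random cubic graphs\<close>

definition expansion_bound :: "nat \<Rightarrow> nat \<Rightarrow> real" where
  "expansion_bound n s = min (9 / 125 * n) (27 / 116 * s)"

text \<open>
  The first summand bounds the contribution of the sets above the breakpoint \<open>s = (116 / 375) n\<close>,
  the second that of the sets below it.
\<close>

definition union_bound_term :: "nat \<Rightarrow> nat \<Rightarrow> real" where
  "union_bound_term n s =
     exp 2 * real s ^ 2 * exp (- real n / 200)
     + 4 * exp 2 * real s ^ 3 * exp (- real s / 50) * real n powr (- 1 / 3)"

lemma cut_size_config_graph_le: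
  assumes P: "P \<in> configurations k n" and U: "U \<subseteq> {1..n}"
  shows "cut_size (config_graph n P) U \<le> k * card U"
proof -
  have "card (crossing P (U \<times> {1..k})) \<le> card (U \<times> {1..k})"
  proof (rule card_crossing_le)
    show "finite (U \<times> {1..k})" using U finite_subset by blast
    show "disjoint P" using P by (auto simp: configurations_def partition_on_def)
  qed
  then show ?thesis by (simp add: cut_size_config_graph [OF P U] card_cartesian_product mult.commute)
qed

text \<open>
  With \<open>k = 3\<close> and \<open>\<alpha> = 9 / 125\<close> the slope \<open>k \<alpha> / (1 - \<alpha>)\<close> is \<open>27 / 116\<close>.
\<close>

lemma gonality_config_graph_ge:
  assumes n: "0 < n" and P: "P \<in> configurations 3 n"
    and expand: "\<And>U. U \<subseteq> {1..n} \<Longrightarrow> U \<noteq> {} \<Longrightarrow> 2 * card U \<le> n \<Longrightarrow>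
      expansion_bound n (card U) \<le> card (crossing P (U \<times> {1..3}))"
  shows "0.072 * real n \<le> gonality (config_graph n P)"
proof -
  have V: "verts (config_graph n P) = {1..n}" by (simp add: config_graph_def)
  have "9 / 125 * card (verts (config_graph n P)) \<le> gonality (config_graph n P)"
  proof (rule gonality_ge_of_expansion [where k = 3])
    fix U assume U: "U \<subseteq> verts (config_graph n P)"
    then show "cut_size (config_graph n P) U \<le> 3 * card U"
      unfolding V by (rule cut_size_config_graph_le [OF P])
    assume U': "U \<noteq> {}" "2 * card U \<le> card (verts (config_graph n P))"
    have "expansion_bound n (card U) \<le> cut_size (config_graph n P) U"
      using expand [of U] U U' cut_size_config_graph [OF P, of U] V by simp
    then show "min (9 / 125 * card (verts (config_graph n P))) (real 3 * (9 / 125) / (1 - 9 / 125) * card U)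
        \<le> cut_size (config_graph n P) U"
      by (simp add: expansion_bound_def V)
  qed (use n in \<open>simp_all add: V\<close>)
  then show ?thesis by (simp add: V)
qed

lemma low_expansion_probability:
  assumes even: "even n" and s: "1 \<le> s" "2 * s \<le> n"
  shows "measure_pmf.prob (pmf_of_set (configurations 3 n))
     {P. \<exists>U \<subseteq> {1..n}. card U = s \<and> card (crossing P (U \<times> {1..3})) < expansion_bound n s}
    \<le> union_bound_term n s"
    (is "?p \<le> _")
proof (cases "116 / 375 * real n \<le> s")
  let ?large = "exp 2 * real s ^ 2 * exp (- real n / 200)"
  case True
  then have b: "expansion_bound n s = 9 / 125 * n" by (simp add: expansion_bound_def)
  have "?p \<le> exp 2 * real s ^ 2 *
      exp (- xlogx_entropy n s / 2 + 3 * (6 / 125) * sqrt (s * (real n - s)) - 9 / 125 * n * ln (6 / 125))"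
    unfolding b using even s by (intro small_crossing_probability_entropy) auto
  also have "\<dots> \<le> ?large"
    using large_set_exponent [of n s] True s by (intro mult_left_mono) auto
  also have "\<dots> \<le> union_bound_term n s" by (simp add: union_bound_term_def)
  finally show ?thesis .
next
  let ?small = "4 * exp 2 * real s ^ 3 * exp (- real s / 50) * real n powr (- 1 / 3)"
  case False
  define w where "w = 9 / 116 * sqrt (s / (real n - s))"
  define r where "r = ln n - ln s - ln (375 / 116)"
  have sr: "0 < real s" "real s \<le> 116 / 375 * n" "0 < real n - s" using s False by auto
  have "sqrt (s / (real n - s)) \<le> 1" using s sr by simp
  then have "w \<le> 1" unfolding w_def by linarith
  moreover have "0 < w" using sr by (simp add: w_def)
  ultimately have w: "0 < w" "w \<le> 1" by simp_all
  have b: "expansion_bound n s = 27 / 116 * s" using sr by (simp add: expansion_bound_def)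
  have "?p \<le> exp 2 * real s ^ 2 *
      exp (- xlogx_entropy n s / 2 + 3 * w * sqrt (s * (real n - s)) - 27 / 116 * s * ln w)"
    unfolding b using even s w by (intro small_crossing_probability_entropy) auto
  also have "\<dots> \<le> exp 2 * real s ^ 2 * exp (- s / 50 - 89 / 232 * s * r)"
    using small_set_exponent [of s n] sr by (intro mult_left_mono) (auto simp: w_def r_def)
  \<comment> \<open>As \<open>s \<ge> 1\<close>, the factor \<open>89 s / 232\<close> may be replaced by \<open>1 / 3\<close>, which leaves \<open>n powr (- 1 / 3)\<close>.\<close>
  also have "\<dots> \<le> exp 2 * real s ^ 2 * exp (- s / 50 - 1 / 3 * r)"
  proof -
    have "ln (375 / 116 * s) \<le> ln n" using sr by (subst ln_le_cancel_iff) auto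
    moreover have "ln (375 / 116 * s) = ln (375 / 116) + ln s" using sr by (intro ln_mult_pos) auto
    ultimately have "0 \<le> r" by (simp add: r_def)
    moreover have "1 / 3 \<le> 89 / 232 * real s" using s by simp
    ultimately have "1 / 3 * r \<le> 89 / 232 * s * r" by (intro mult_right_mono)
    then show ?thesis by (intro mult_left_mono) auto
  qed
  also have "\<dots> \<le> exp 2 * real s ^ 2 * (exp (- s / 50) * (4 * real s * n powr (- 1 / 3)))"
  proof -
    have "1 / 3 * ln (375 / 116 :: real) \<le> 1 * ln (375 / 116)" by (intro mult_right_mono) auto
    also have "\<dots> \<le> ln 4" by simp
    finally have "1 / 3 * ln (375 / 116 :: real) \<le> ln 4" .
    moreover have "1 / 3 * ln s \<le> 1 * ln s" using s by (intro mult_right_mono) auto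
    ultimately have "1 / 3 * ln s + 1 / 3 * ln (375 / 116) \<le> ln s + ln 4" by (intro add_mono) simp_all
    moreover have "- 1 / 3 * r = 1 / 3 * ln s + 1 / 3 * ln (375 / 116) - 1 / 3 * ln n"
      unfolding r_def by (simp only: algebra_simps)
    ultimately have "- 1 / 3 * r \<le> ln s + ln 4 - 1 / 3 * ln n" by (metis diff_right_mono)
    then have "exp (- 1 / 3 * r) \<le> exp (ln s + ln 4 - 1 / 3 * ln n)" by simp
    also have "\<dots> = exp (ln s) * exp (ln 4) * exp (- 1 / 3 * ln n)"
      unfolding exp_add [symmetric] by simp
    also have "\<dots> = 4 * real s * n powr (- 1 / 3)" using s by (simp add: powr_def)
    finally have "exp (- s / 50 - 1 / 3 * r) \<le> exp (- s / 50) * (4 * real s * n powr (- 1 / 3))"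
      using exp_add [of "- s / 50" "- 1 / 3 * r"] by simp
    then show ?thesis by (intro mult_left_mono) auto
  qed
  also have "\<dots> = ?small" by (simp add: power2_eq_square power3_eq_cube)
  also have "\<dots> \<le> union_bound_term n s" by (simp add: union_bound_term_def)
  finally show ?thesis .
qed

text \<open>
  The first summands add up to at most \<open>n ^ 3\<close> times a decaying exponential. The
  second are \<open>n powr (- 1 / 3)\<close> times the terms of a convergent series.
\<close>

lemma sum_union_bound_term_tendsto_0:
  "(\<lambda>n. \<Sum>s=1..n div 2. union_bound_term n s) \<longlonglongrightarrow> 0"
proof -
  define a where "a s = 4 * exp 2 * real s ^ 3 * exp (- real s / 50)" for s
  have a: "summable a"
  proof (rule summable_comparison_test_ev)
    have "\<forall>\<^sub>F s in sequentially. 4 * exp 2 * real s ^ 3 * exp (- real s / 50) \<le> exp (- real s / 100)"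
      by real_asymp
    then show "\<forall>\<^sub>F s in sequentially. norm (a s) \<le> exp (- real s / 100)"
      by (simp add: a_def)
    have "exp (- real s / 100) = exp (- 1 / 100) ^ s" for s by (simp flip: exp_of_nat_mult)
    then show "summable (\<lambda>s. exp (- real s / 100))" by simp
  qed
  have a0: "a s \<ge> 0" for s by (simp add: a_def)
  have "(\<lambda>n. exp 2 * real n ^ 3 * exp (- real n / 200)) \<longlonglongrightarrow> 0" by real_asymp
  moreover have "(\<lambda>n. real n powr (- 1 / 3)) \<longlonglongrightarrow> 0" by real_asymp
  then have "(\<lambda>n. suminf a * real n powr (- 1 / 3)) \<longlonglongrightarrow> 0" by (rule tendsto_mult_right_zero)
  ultimately have "(\<lambda>n. exp 2 * real n ^ 3 * exp (- real n / 200) + suminf a * real n powr (- 1 / 3)) \<longlonglongrightarrow> 0"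
    by (rule tendsto_add_zero)
  then show ?thesis
  proof (rule tendsto_sandwich [OF _ _ tendsto_const, rotated 2])
    show "\<forall>\<^sub>F n in sequentially. 0 \<le> (\<Sum>s=1..n div 2. union_bound_term n s)"
      by (intro always_eventually allI sum_nonneg) (simp add: union_bound_term_def)
    show "\<forall>\<^sub>F n in sequentially. (\<Sum>s=1..n div 2. union_bound_term n s)
      \<le> exp 2 * real n ^ 3 * exp (- real n / 200) + suminf a * real n powr (- 1 / 3)"
    proof (intro always_eventually allI)
      fix n :: nat
      have "(\<Sum>s=1..n div 2. exp 2 * real s ^ 2 * exp (- real n / 200))
          \<le> (\<Sum>s=1..n div 2. exp 2 * real n ^ 2 * exp (- real n / 200))"
        by (intro sum_mono mult_right_mono mult_left_mono power_mono) auto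
      also have "\<dots> = real (n div 2) * (exp 2 * real n ^ 2 * exp (- real n / 200))" by simp
      also have "\<dots> \<le> real n * (exp 2 * real n ^ 2 * exp (- real n / 200))"
        by (intro mult_right_mono) auto
      finally have 1: "(\<Sum>s=1..n div 2. exp 2 * real s ^ 2 * exp (- real n / 200))
          \<le> exp 2 * real n ^ 3 * exp (- real n / 200)"
        by (simp add: power2_eq_square power3_eq_cube mult_ac)
      have "(\<Sum>s=1..n div 2. a s * real n powr (- 1 / 3)) = sum a {1..n div 2} * real n powr (- 1 / 3)"
        by (simp add: sum_distrib_right)
      also have "\<dots> \<le> suminf a * real n powr (- 1 / 3)"
        using sum_le_suminf [OF a, of "{1..n div 2}"] a0 by (intro mult_right_mono) auto
      finally show "(\<Sum>s=1..n div 2. union_bound_term n s)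
      \<le> exp 2 * real n ^ 3 * exp (- real n / 200) + suminf a * real n powr (- 1 / 3)"
        using 1 by (simp add: union_bound_term_def sum.distrib a_def)
    qed
  qed
qed

lemma gonality_probability_ge:
  assumes even: "even n" and n: "0 < n"
  shows "1 - (\<Sum>s=1..n div 2. union_bound_term n s)
    \<le> measure_pmf.prob (random_regular_graph 3 n) {G. 0.072 * real n \<le> real_of_int (gonality G)}"
proof -
  define M where "M = pmf_of_set (configurations 3 n)"
  define bad where "bad s = {P :: (nat \<times> nat) set set. \<exists>U \<subseteq> {1..n}. card U = s \<and> card (crossing P (U \<times> {1..3})) < expansion_bound n s}" for s
  have "finite (configurations 3 n)" by (simp add: configurations_eq_pairings finite_pairings)
  moreover have "configurations 3 n \<noteq> {}"
    unfolding configurations_eq_pairings by (rule pairings_nonempty) (use even in \<open>simp_all add: card_cartesian_product\<close>)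
  ultimately have M: "set_pmf M = configurations 3 n" by (simp add: M_def)
  have "1 - measure_pmf.prob M (\<Union>s\<in>{1..n div 2}. bad s) = measure_pmf.prob M (UNIV - (\<Union>s\<in>{1..n div 2}. bad s))"
    using measure_pmf.prob_compl [of "\<Union>s\<in>{1..n div 2}. bad s" M] by simp
  also have "\<dots> \<le> measure_pmf.prob M (config_graph n -` {G. 0.072 * real n \<le> real_of_int (gonality G)})"
  proof (rule measure_pmf.finite_measure_mono_AE)
    show "AE P in M. P \<in> UNIV - (\<Union>s\<in>{1..n div 2}. bad s) \<longrightarrow>
        P \<in> config_graph n -` {G. 0.072 * real n \<le> real_of_int (gonality G)}"
    proof (rule AE_pmfI, rule impI)
      fix P assume P: "P \<in> set_pmf M" "P \<in> UNIV - (\<Union>s\<in>{1..n div 2}. bad s)"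
      have "0.072 * real n \<le> gonality (config_graph n P)"
      proof (rule gonality_config_graph_ge [OF n])
        show "P \<in> configurations 3 n" using P M by simp
        fix U assume U: "U \<subseteq> {1..n}" "U \<noteq> {}" "2 * card U \<le> n"
        have "finite U" using U(1) finite_subset by blast
        then have "card U \<in> {1..n div 2}" using U by (auto simp: Suc_le_eq card_gt_0_iff)
        with P(2) have "P \<notin> bad (card U)" by blast
        then show "expansion_bound n (card U) \<le> card (crossing P (U \<times> {1..3}))"
          using U(1) by (force simp: bad_def)
      qed
      then show "P \<in> config_graph n -` {G. 0.072 * real n \<le> real_of_int (gonality G)}" by simp
    qed
  qed auto
  also have "\<dots> = measure_pmf.prob (random_regular_graph 3 n) {G. 0.072 * real n \<le> real_of_int (gonality G)}"
    by (simp add: random_regular_graph_def M_def measure_map_pmf)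
  finally have 1: "1 - measure_pmf.prob M (\<Union>s\<in>{1..n div 2}. bad s) \<le> \<dots>" .
  have "measure_pmf.prob M (\<Union>s\<in>{1..n div 2}. bad s) \<le> (\<Sum>s=1..n div 2. measure_pmf.prob M (bad s))"
    by (intro measure_pmf.finite_measure_subadditive_finite) auto
  also have "\<dots> \<le> (\<Sum>s=1..n div 2. union_bound_term n s)"
    unfolding M_def bad_def by (intro sum_mono low_expansion_probability even) auto
  finally show ?thesis using 1 by linarith
qed

theorem theorem1p2:
  "((\<lambda>n. measure_pmf.prob (random_regular_graph 3 n)
            {G. real_of_int (gonality G) \<ge> 0.072 * real n})
      \<longlongrightarrow> 1) (inf sequentially (principal {n. even n}))"
proof (rule tendsto_sandwich [OF _ _ _ tendsto_const])
  let ?F = "inf sequentially (principal {n::nat. even n})"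
  let ?e = "\<lambda>n. \<Sum>s=1..n div 2. union_bound_term n s"
  show "\<forall>\<^sub>F n in ?F. 1 - ?e n \<le> measure_pmf.prob (random_regular_graph 3 n) {G. real_of_int (gonality G) \<ge> 0.072 * real n}"
    unfolding eventually_inf_principal
    using eventually_gt_at_top [of 0] by eventually_elim (intro impI gonality_probability_ge, auto)
  show "\<forall>\<^sub>F n in ?F. measure_pmf.prob (random_regular_graph 3 n) {G. real_of_int (gonality G) \<ge> 0.072 * real n} \<le> 1"
    by (intro always_eventually allI measure_pmf.prob_le_1)
  have "(\<lambda>n. 1 - ?e n) \<longlonglongrightarrow> 1 - 0"
    by (intro tendsto_diff tendsto_const sum_union_bound_term_tendsto_0)
  then show "((\<lambda>n. 1 - ?e n) \<longlongrightarrow> 1) ?F"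
    by (simp add: tendsto_mono [OF inf_le1] del: One_nat_def)
qed

end
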